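(* Let $q$ be a prime power, $n,\ell\ge 1$ and $\xi\in[0,1]$. Suppose $\mathcal{S}\subseteq\mathcal{T}_{n,\ell}$ satisfies: (1) $\mu(\mathcal{S})\le\xi$; (2) $\mathcal{S}$ is $\xi$-pseudorandom with respect to zoom-outs, zoom-outs on the linear part, and zoom-ins on the linear part; (3) $1-\Phi(\mathcal{S})\ge \frac1q$, where $\Phi$ is edge expansion in $\mathrm{AffBilin}(n,\ell)$. Then there exist $a\in\mathbb{F}_q^\ell$ and $b\in\mathbb{F}_q^n$ such that $$\mu(\mathcal{S}_{a,b})\ge 1-\frac{1}{(q-1)^2}-\frac{q^3}{q-1}\left(4q^{-\ell}+867\,\xi^{1/4}\right),$$ where $\mu(\mathcal{S}_{a,b})=\Pr_{T\in\mathcal{C}_{a,b}}[T\in\mathcal{S}]$.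
   Context: $\mathcal{T}_{n,\ell}$ is the set of affine maps $T=(M,c)\colon\mathbb{F}_q^\ell\to\mathbb{F}_q^n$, $Tx=Mx+c$, $M\in\mathbb{F}_q^{n\times\ell}$, $c\in\mathbb{F}_q^n$ (not necessarily full rank); $\mu(\mathcal{S})=|\mathcal{S}|/|\mathcal{T}_{n,\ell}|$. The affine bilinear scheme graph $\mathrm{AffBilin}(n,\ell)$ has vertex set $\mathcal{T}_{n,\ell}$, two vertices $T_1,T_2$ being adjacent iff they agree on an $(\ell-1)$-dimensional affine subspace of $\mathbb{F}_q^\ell$. For a regular graph and vertex set $S$, the edge expansion is $\Phi(S)=\Pr_{u\in S,\,(u,v)\in E}[v\notin S]$. Canonical sets: zoom-ins $\mathcal{C}_{a,b}=\{T: T(a)=b\}$ ($a\in\mathbb{F}_q^\ell,b\in\mathbb{F}_q^n$); zoom-outs $\mathcal{C}_{a^T,b,\beta}=\{(M,c): a^TM=b,\ a^Tc=\beta\}$ ($a\in\mathbb{F}_q^n$, $b\in\mathbb{F}_q^\ell$ a row vector, $\beta\in\mathbb{F}_q$); zoom-ins on the linear part $\mathcal{C}_{a,b,\mathrm{lin}}=\{(M,c): Ma=b\}$ ($a\in\mathbb{F}_q^\ell,b\in\mathbb{F}_q^n$); zoom-outs on the linear part $\mathcal{C}_{a^T,b,\mathrm{lin}}=\{(M,c): a^TM=b\}$ ($a\in\mathbb{F}_q^n,b\in\mathbb{F}_q^\ell$). $\mathcal{S}$ is $\xi$-pseudorandom with respect to a type of canonical set if for every (nonempty) set $\mathcal{C}$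 of that type, $\Pr_{T\in\mathcal{C}}[T\in\mathcal{S}]\le\xi$. *)

theory Defs
  imports "HOL-Analysis.Cartesian_Space"
begin

text \<open>
  The field with \<open>q\<close> elements is an arbitrary finite field type \<open>'f\<close> with \<open>q = CARD('f)\<close>;
  the dimensions are \<open>n = CARD('n)\<close> and \<open>\<ell> = CARD('l)\<close>, both automatically at least 1.
  A pair \<open>(M, c)\<close> determines and is determined by the map \<open>x \<mapsto> M x + c\<close>, so the set of all
  affine maps is the whole type.
\<close>

type_synonym ('f, 'n, 'l) affmap = "('f ^ 'l ^ 'n) \<times> ('f ^ 'n)"

definition aff_apply :: "('f::field, 'n::finite, 'l::finite) affmap \<Rightarrow> 'f ^ 'l \<Rightarrow> 'f ^ 'n" where
  "aff_apply T x = fst T *v x + snd T"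

definition affine_subspace_dim :: "nat \<Rightarrow> ('f::field ^ 'l::finite) set \<Rightarrow> bool" where
  "affine_subspace_dim d A \<longleftrightarrow>
     (\<exists>x W. vec.subspace W \<and> vec.dim W = d \<and> A = (\<lambda>w. x + w) ` W)"

text \<open>
  The graph has no loops. For distinct maps the full agreement set has dimension at most
  \<open>\<ell> - 1\<close>, so agreeing on some such subspace means that it is the whole agreement set.
\<close>

definition affbilin_adj ::
    "('f::field, 'n::finite, 'l::finite) affmap \<Rightarrow> ('f, 'n, 'l) affmap \<Rightarrow> bool" where
  "affbilin_adj T1 T2 \<longleftrightarrow>
     T1 \<noteq> T2 \<and>
     (\<exists>A :: ('f ^ 'l) set. affine_subspace_dim (CARD('l) - 1) A \<and>
        (\<forall>x\<in>A. aff_apply T1 x = aff_apply T2 x))"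

text \<open>Meaningful only if some edge leaves a vertex of \<open>S\<close>; otherwise the quotient is \<open>0 / 0 = 0\<close>.\<close>

definition edge_expansion :: "('v \<Rightarrow> 'v \<Rightarrow> bool) \<Rightarrow> 'v set \<Rightarrow> real" where
  "edge_expansion E S =
     real (card {(u, v). u \<in> S \<and> E u v \<and> v \<notin> S}) / real (card {(u, v). u \<in> S \<and> E u v})"

text \<open>The probability that a uniformly random element of the finite nonempty set \<open>C\<close> is in \<open>S\<close>.\<close>

definition density_in :: "'v set \<Rightarrow> 'v set \<Rightarrow> real" where
  "density_in C S = real (card (C \<inter> S)) / real (card C)"

definition zoom_in ::
    "'f ^ 'l \<Rightarrow> 'f ^ 'n \<Rightarrow> ('f::field, 'n::finite, 'l::finite) affmap set" where
  "zoom_in a b = {T. aff_apply T a = b}"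

definition zoom_out ::
    "'f ^ 'n \<Rightarrow> 'f ^ 'l \<Rightarrow> 'f \<Rightarrow> ('f::field, 'n::finite, 'l::finite) affmap set" where
  "zoom_out a b \<beta> = {(M, c). a v* M = b \<and> (\<Sum>i\<in>UNIV. a $ i * c $ i) = \<beta>}"

definition zoom_in_lin ::
    "'f ^ 'l \<Rightarrow> 'f ^ 'n \<Rightarrow> ('f::field, 'n::finite, 'l::finite) affmap set" where
  "zoom_in_lin a b = {(M, c). M *v a = b}"

definition zoom_out_lin ::
    "'f ^ 'n \<Rightarrow> 'f ^ 'l \<Rightarrow> ('f::field, 'n::finite, 'l::finite) affmap set" where
  "zoom_out_lin a b = {(M, c). a v* M = b}"

definition pseudorandom :: "real \<Rightarrow> 'v set set \<Rightarrow> 'v set \<Rightarrow> bool" where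
  "pseudorandom \<xi> \<C> S \<longleftrightarrow> (\<forall>C\<in>\<C>. C \<noteq> {} \<longrightarrow> density_in C S \<le> \<xi>)"

end

theory Submission
  imports Defs "HOL-Analysis.Convex"
begin

text \<open>
  Adjoining the constant column turns affine maps into matrices, and the graph into a Cayley graph on
  matrices whose generators have rank one. Its eigenvalue on a character of rank \<open>r\<close> is at most
  \<open>q\<^sup>-\<^sup>r\<close>, so if \<open>S\<close> retains a fraction \<open>1 / q\<close> of its edges, then almost all Fourier
  energy of the indicator of \<open>S\<close> sits on rank-one characters, and the projection \<open>f\<^sub>1\<close> to them is close
  to \<open>1\<close> on average over \<open>S\<close>.
  Expanding the second moment of \<open>f\<^sub>1\<close> over \<open>S\<close> into pairs of rank-one characters, the pairs with a
  common kernel are controlled by the densities of \<open>S\<close> in zoom-ins, those with a common left kernel by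
  the densities in zoom-outs, and the remaining ones by the tiny energy on rank two. As the
  zoom-outs and the linear zoom-ins are sparse, some affine zoom-in must have density \<open>1 - O(q\<^sup>3 \<xi>)\<close>,
  which is stronger than the claimed bound.
\<close>

text \<open>The threshold 1/q is exactly the eigenvalue bound for rank one. When the edge count
  inside \<open>S\<close> is compared with Parseval, the rank-one energy has the same coefficient on
  both sides and cancels. Only the trivial character pays for ranks above one, so their energy is at
  most q s^2 with s = |S|, against a total energy N s, where N is the number of matrices.

  Densities enter because rank-one characters with proportional v sum to a function of T v alone.
  Its second moment over \<open>S\<close> is at most the largest zoom-in density times its second
  moment over all matrices. The obstacle is the cross terms between different v. Summed over
  \<open>S\<close>, they become Fourier coefficients of \<open>S\<close> at differences X - X',
  which lie above rank one unless a kernel or a left kernel is shared.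

  A matrix above rank one is such a difference in at most q^4 ways, so Cauchy-Schwarz costs q^2, and
  the square root of the energy above rank one is at most q s \<le> q \<xi> N. This is the origin of
  q^3 \<xi>.\<close>

section \<open>Additive characters and bilinear pairings\<close>

text \<open>The quotient by a maximal proper subgroup is cyclic, generated by any element outside of it.\<close>

lemma ex_additive_character:
  shows "\<exists>\<psi> :: 'f::{field,finite} \<Rightarrow> complex.
    (\<forall>x y. \<psi> (x + y) = \<psi> x * \<psi> y) \<and> (\<forall>x. norm (\<psi> x) = 1) \<and> (\<exists>x. \<psi> x \<noteq> 1)"
proof -
  define subgrp where
    "subgrp H \<longleftrightarrow> 0 \<in> H \<and> (\<forall>x\<in>H. \<forall>y\<in>H. x - y \<in> H)" for H :: "'f set"
  have subgrp_add: "x + y \<in> H" if "subgrp H" "x \<in> H" "y \<in> H" for H and x y :: 'f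
    using that unfolding subgrp_def by (metis diff_0 diff_minus_eq_add)
  have "finite {H. subgrp H \<and> H \<noteq> UNIV}" by simp
  moreover have "{0} \<in> {H. subgrp H \<and> H \<noteq> UNIV}"
    by (auto simp: subgrp_def) (metis UNIV_I singletonD zero_neq_one)
  ultimately obtain H where "H \<in> {H. subgrp H \<and> H \<noteq> UNIV}"
    and "\<forall>K\<in>{H. subgrp H \<and> H \<noteq> UNIV}. H \<subseteq> K \<longrightarrow> H = K"
    using finite_has_maximal[of "{H. subgrp H \<and> H \<noteq> UNIV}"] by blast
  then have H: "subgrp H" "H \<noteq> UNIV"
    and max: "\<And>K. subgrp K \<Longrightarrow> K \<noteq> UNIV \<Longrightarrow> H \<subseteq> K \<Longrightarrow> K = H"
    by blast+
  obtain x where x: "x \<notin> H" using H(2) by blast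
  have gen: "\<exists>k. y - of_int k * x \<in> H" for y
  proof -
    define K where "K = {y. \<exists>k. y - of_int k * x \<in> H}"
    have "subgrp K"
      unfolding subgrp_def
    proof (intro conjI ballI)
      show "0 \<in> K" unfolding K_def using H(1) by (auto simp: subgrp_def intro!: exI[of _ 0])
    next
      fix y z assume "y \<in> K" "z \<in> K"
      then obtain k j where "y - of_int k * x \<in> H" "z - of_int j * x \<in> H"
        unfolding K_def by blast
      then have "(y - of_int k * x) - (z - of_int j * x) \<in> H"
        using H(1) unfolding subgrp_def by blast
      then have "(y - z) - of_int (k - j) * x \<in> H" by (simp add: algebra_simps)
      then show "y - z \<in> K" unfolding K_def by blast
    qed
    moreover have "H \<subseteq> K" unfolding K_def by (auto intro!: exI[of _ 0])
    moreover have "x \<in> K" unfolding K_def using H(1) by (auto simp: subgrp_def intro!: exI[of _ 1])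
    ultimately have "K = UNIV" using max x by blast
    then show ?thesis unfolding K_def by blast
  qed
  have "\<exists>m>0. (of_nat m :: 'f) = 0"
  proof -
    have "\<not> inj (of_nat :: nat \<Rightarrow> 'f)" using finite_imageD[of "of_nat :: nat \<Rightarrow> 'f" UNIV] by auto
    then obtain i j where "i < j" "(of_nat i :: 'f) = of_nat j"
      unfolding inj_def by (metis linorder_neqE_nat)
    then show ?thesis by (intro exI[of _ "j - i"]) (simp add: of_nat_diff)
  qed
  then have ex: "\<exists>m>0. of_nat m * x \<in> H" using H(1) by (auto simp: subgrp_def)
  \<comment> \<open>\<open>m\<close> is the order of \<open>x\<close> in the quotient by
    \<open>H\<close>. Sending \<open>x\<close> to a primitive \<open>m\<close>-th root of unity is
    well defined by \<open>dvd\<close>, and nontrivial because \<open>x \<notin> H\<close> rules out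
    \<open>m = 1\<close>.\<close>
  define m where "m = (LEAST m. m > 0 \<and> of_nat m * x \<in> H)"
  have m: "m > 0" "of_nat m * x \<in> H" using LeastI_ex[OF ex] unfolding m_def by auto
  have m_le: "m \<le> j" if "j > 0" "of_nat j * x \<in> H" for j
    unfolding m_def using that by (auto intro: Least_le)
  have "m \<noteq> 1" using m(2) x by auto
  have dvd: "int m dvd k" if k: "of_int k * x \<in> H" for k
  proof -
    have mult: "of_nat i * (of_nat m * x) \<in> H" for i
      by (induction i) (use H(1) m(2) subgrp_add in \<open>auto simp: subgrp_def algebra_simps\<close>)
    have multi: "of_int i * (of_nat m * x) \<in> H" for i
    proof (cases i)
      case (nonneg n) then show ?thesis using mult by simp
    next
      case (neg n)
      have "0 - of_nat (Suc n) * (of_nat m * x) \<in> H"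
        using H(1) mult[of "Suc n"] unfolding subgrp_def by blast
      moreover have "of_int i = (- of_nat (Suc n) :: 'f)" using neg by simp
      ultimately show ?thesis by (simp only: diff_0 mult_minus_left)
    qed
    have "of_int k * x - of_int (k div int m) * (of_nat m * x) \<in> H"
      using H(1) k multi unfolding subgrp_def by blast
    moreover have "of_int k * x - of_int (k div int m) * (of_nat m * x) = of_nat (nat (k mod int m)) * x"
    proof -
      have "of_nat (nat (k mod int m)) = (of_int (k mod int m) :: 'f)"
        using m(1) by (simp add: of_nat_nat)
      also have "\<dots> = of_int (k - k div int m * int m)"
        by (simp add: minus_div_mult_eq_mod)
      finally have "of_nat (nat (k mod int m)) = (of_int k - of_int (k div int m) * of_nat m :: 'f)"
        by simp
      then show ?thesis by (simp only: left_diff_distrib mult.assoc)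
    qed
    ultimately have "of_nat (nat (k mod int m)) * x \<in> H" by simp
    moreover have "nat (k mod int m) < m" using m(1)
      by (metis nat_less_iff of_nat_0_less_iff pos_mod_bound pos_mod_sign)
    ultimately have "nat (k mod int m) = 0" using m_le by (meson leD neq0_conv)
    then have "k mod int m = 0" using m(1) by (simp add: nat_eq_iff pos_mod_sign)
    then show ?thesis by auto
  qed
  define \<zeta> where "\<zeta> k = cis (2 * pi * real_of_int k / real m)" for k
  have \<zeta>_add: "\<zeta> (k + j) = \<zeta> k * \<zeta> j" for k j
    unfolding \<zeta>_def by (simp add: cis_mult ring_distribs add_divide_distrib)
  have \<zeta>_dvd: "\<zeta> k = 1" if dv: "int m dvd k" for k
  proof -
    obtain j where j: "k = int m * j" using dv by (elim dvdE)
    have "2 * pi * real_of_int k / real m = 2 * pi * real_of_int j"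
      using m(1) j by simp
    then show ?thesis unfolding \<zeta>_def by simp
  qed
  have \<zeta>_cong: "\<zeta> k = \<zeta> j" if "y - of_int k * x \<in> H" "y - of_int j * x \<in> H" for k j y
  proof -
    have "(y - of_int j * x) - (y - of_int k * x) \<in> H"
      using H(1) that unfolding subgrp_def by blast
    then have "of_int (k - j) * x \<in> H" by (simp add: algebra_simps)
    then have "\<zeta> (k - j) = 1" using dvd \<zeta>_dvd by blast
    then show ?thesis using \<zeta>_add[of "k - j" j] by simp
  qed
  define \<psi> where "\<psi> y = \<zeta> (SOME k. y - of_int k * x \<in> H)" for y
  have \<psi>_eq: "\<psi> y = \<zeta> k" if "y - of_int k * x \<in> H" for y k
    unfolding \<psi>_def using \<zeta>_cong[OF someI_ex[OF gen] that] .
  have "\<psi> (y + z) = \<psi> y * \<psi> z" for y z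
  proof -
    obtain k j where kj: "y - of_int k * x \<in> H" "z - of_int j * x \<in> H" using gen by meson
    then have "(y + z) - of_int (k + j) * x \<in> H"
      using subgrp_add[OF H(1) kj] by (simp add: algebra_simps)
    then show ?thesis using kj \<psi>_eq \<zeta>_add by metis
  qed
  moreover have "norm (\<psi> y) = 1" for y
    unfolding \<psi>_def \<zeta>_def by simp
  moreover have "\<psi> x \<noteq> 1"
  proof
    assume "\<psi> x = 1"
    moreover have "\<psi> x = \<zeta> 1" using H(1) by (intro \<psi>_eq) (auto simp: subgrp_def)
    ultimately have "cis (2 * pi * (1 / real m)) = 1" unfolding \<zeta>_def by simp
    then obtain i :: int where i: "2 * pi * (1 / real m) = 2 * pi * i"
      by (auto simp: complex_eq_iff cos_one_2pi_int mult.commute mult.left_commute)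
    then have "1 = of_int i * real m" using m(1) by (simp add: field_simps)
    then have "1 = i * int m" by (metis of_int_1 of_int_eq_iff of_int_mult of_int_of_nat_eq)
    then show False using \<open>m \<noteq> 1\<close>
      by (metis mult.commute nat_int nat_one_as_int pos_zmult_eq_1_iff m(1) of_nat_0_less_iff)
  qed
  ultimately show ?thesis by blast
qed

definition dot :: "'f::field ^ 'm::finite \<Rightarrow> 'f ^ 'm \<Rightarrow> 'f" where
  "dot x y = (\<Sum>i\<in>UNIV. x $ i * y $ i)"

text \<open>The trace form tr(X^T T). For a fixed nontrivial additive character,
  \<open>\<psi> (mdot X T)\<close> as a function of \<open>T\<close> runs through all characters of
  the additive group of matrices as \<open>X\<close> varies.\<close>

definition mdot :: "'f::field ^ 'm::finite ^ 'n::finite \<Rightarrow> 'f ^ 'm ^ 'n \<Rightarrow> 'f" where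
  "mdot X T = (\<Sum>i\<in>UNIV. dot (X $ i) (T $ i))"

definition outer :: "'f::field ^ 'n::finite \<Rightarrow> 'f ^ 'm::finite \<Rightarrow> 'f ^ 'm ^ 'n" where
  "outer u v = (\<chi> i j. u $ i * v $ j)"

lemma outer_nth [simp]: "outer u v $ i $ j = u $ i * v $ j"
  by (simp add: outer_def)

lemma dot_add_left: "dot (x + y) z = dot x z + dot y z"
  and dot_add_right: "dot z (x + y) = dot z x + dot z y"
  and dot_minus_left: "dot (- x) z = - dot x z"
  and dot_minus_right: "dot z (- x) = - dot z x"
  and dot_scale_left: "dot (c *s x) z = c * dot x z"
  and dot_scale_right: "dot z (c *s x) = c * dot z x"
  by (simp_all add: dot_def algebra_simps sum.distrib sum_negf sum_distrib_left)

lemma dot_diff_right: "dot z (x - y) = dot z x - dot z y"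
  using dot_add_right[of z x "- y"] by (simp add: dot_minus_right)

lemma dot_zero [simp]: "dot 0 x = 0" "dot x 0 = 0"
  by (simp_all add: dot_def)

lemma dot_commute: "dot x y = dot y x"
  by (simp add: dot_def mult.commute)

lemma dot_axis: "dot x (axis j c) = x $ j * c"
  by (simp add: dot_def axis_def if_distrib sum.delta cong: if_cong)

lemma mdot_add_right: "mdot X (S + T) = mdot X S + mdot X T"
  and mdot_add_left: "mdot (S + T) X = mdot S X + mdot T X"
  and mdot_minus_right: "mdot X (- T) = - mdot X T"
  and mdot_minus_left: "mdot (- T) X = - mdot T X"
  by (simp_all add: mdot_def dot_add_right dot_add_left dot_minus_right dot_minus_left
      sum.distrib sum_negf)

lemma mdot_diff_right: "mdot X (S - T) = mdot X S - mdot X T"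
  and mdot_diff_left: "mdot (S - T) X = mdot S X - mdot T X"
  using mdot_add_right[of X S "- T"] mdot_add_left[of S "- T" X]
  by (simp_all add: mdot_minus_right mdot_minus_left)

lemma mdot_zero [simp]: "mdot 0 X = 0" "mdot X 0 = 0"
  by (simp_all add: mdot_def)

lemma mdot_commute: "mdot X Y = mdot Y X"
  by (simp add: mdot_def dot_commute)

text \<open>The source of the zoom sets: the character of a rank-one matrix sees \<open>T\<close>
  only through \<open>T *v v\<close> and, by \<open>mdot_outer'\<close>, only through
  \<open>u v* T\<close>.\<close>

lemma mdot_outer: "mdot (outer u v) T = dot u (T *v v)"
  by (simp add: mdot_def dot_def matrix_vector_mult_def sum_distrib_left ac_simps)

lemma mdot_outer': "mdot (outer u v) T = dot (u v* T) v"
proof -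
  have "mdot (outer u v) T = (\<Sum>i\<in>UNIV. \<Sum>j\<in>UNIV. u $ i * v $ j * T $ i $ j)"
    by (simp add: mdot_def dot_def)
  also have "\<dots> = (\<Sum>j\<in>UNIV. \<Sum>i\<in>UNIV. u $ i * v $ j * T $ i $ j)"
    by (rule sum.swap)
  finally show ?thesis
    by (simp add: dot_def vector_matrix_mult_def sum_distrib_left sum_distrib_right ac_simps)
qed

lemma outer_mult_vec: "outer u v *v w = dot v w *s u"
  by (simp add: vec_eq_iff matrix_vector_mult_def dot_def sum_distrib_left sum_distrib_right ac_simps)

lemma vec_mult_outer: "w v* outer u v = dot w u *s v"
  by (simp add: vec_eq_iff vector_matrix_mult_def dot_def sum_distrib_left sum_distrib_right ac_simps)

lemma outer_eq_0_iff [simp]: "outer u v = 0 \<longleftrightarrow> u = 0 \<or> v = 0"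
  by (auto simp: vec_eq_iff)

lemma outer_scale: "outer (c *s u) v = outer u (c *s v)"
  by (simp add: vec_eq_iff ac_simps)

section \<open>Orthogonality relations for a fixed nontrivial character\<close>

locale additive_character =
  fixes \<psi> :: "'f::{field,finite} \<Rightarrow> complex"
  assumes add: "\<psi> (x + y) = \<psi> x * \<psi> y"
    and norm_eq_1 [simp]: "norm (\<psi> x) = 1"
    and nontrivial: "\<exists>x. \<psi> x \<noteq> 1"
begin

lemma zero [simp]: "\<psi> 0 = 1"
  using add[of 0 0] norm_eq_1[of 0] by (metis add_0 mult_cancel_left1 norm_zero zero_neq_one)

lemma minus: "\<psi> (- x) = cnj (\<psi> x)"
proof -
  have "\<psi> (- x) * \<psi> x = 1" using add[of "- x" x] by simp
  moreover have "cnj (\<psi> x) * \<psi> x = 1"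
    by (metis complex_norm_square mult.commute norm_eq_1 of_real_1 power_one)
  ultimately show ?thesis by (metis mult_cancel_right mult_zero_right zero_neq_one)
qed

lemma diff: "\<psi> (x - y) = \<psi> x * cnj (\<psi> y)"
  using add[of x "- y"] by (simp add: minus)

text \<open>Translating the summation variable by \<open>z\<close> multiplies the sum by
  \<open>\<psi> c \<noteq> 1\<close>, so it vanishes. The orthogonality relations below choose
  \<open>z\<close> so that \<open>c\<close> is a point where \<open>\<psi>\<close> differs from
  1.\<close>

lemma sum_eq_0:
  assumes "finite A" and \<phi>: "\<And>x. x \<in> A \<Longrightarrow> \<phi> (x + z) = \<phi> x + c" "\<psi> c \<noteq> 1"
    and bij: "bij_betw (\<lambda>x. x + z) A A"
  shows "(\<Sum>x\<in>A. \<psi> (\<phi> x)) = 0"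
proof -
  have "(\<Sum>x\<in>A. \<psi> (\<phi> x)) = (\<Sum>x\<in>A. \<psi> (\<phi> (x + z)))"
    using sum.reindex_bij_betw[OF bij, of "\<lambda>x. \<psi> (\<phi> x)"] by simp
  also have "\<dots> = \<psi> c * (\<Sum>x\<in>A. \<psi> (\<phi> x))"
    by (simp add: \<phi> add sum_distrib_left mult.commute)
  finally show ?thesis using \<phi>(2) by (metis mult_cancel_right1)
qed

lemma sum_dot: "(\<Sum>w\<in>UNIV. \<psi> (dot y w)) = (if y = 0 then of_nat CARD('f ^ 'm) else 0)"
  for y :: "'f ^ 'm::finite"
proof (cases "y = 0")
  case False
  then obtain j where j: "y $ j \<noteq> 0" by (auto simp: vec_eq_iff)
  obtain x where x: "\<psi> x \<noteq> 1" using nontrivial by blast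
  have "(\<Sum>w\<in>UNIV. \<psi> (dot y w)) = 0"
    by (rule sum_eq_0[where z = "axis j (x / y $ j)" and c = x])
      (use j x in \<open>auto simp: dot_add_right dot_axis bij_plus_right\<close>)
  then show ?thesis using False by simp
qed simp

lemma sum_mdot: "(\<Sum>T\<in>UNIV. \<psi> (mdot X T)) = (if X = 0 then of_nat CARD('f ^ 'm ^ 'n) else 0)"
  for X :: "'f ^ 'm::finite ^ 'n::finite"
proof (cases "X = 0")
  case False
  then obtain i j where j: "X $ i $ j \<noteq> 0" by (auto simp: vec_eq_iff)
  obtain x where x: "\<psi> x \<noteq> 1" using nontrivial by blast
  have "mdot X (axis i (axis j c)) = X $ i $ j * c" for c
  proof -
    have "mdot X (axis i (axis j c)) = (\<Sum>k\<in>UNIV. if k = i then dot (X $ k) (axis j c) else 0)"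
      unfolding mdot_def by (rule sum.cong) (auto simp: axis_def[of i])
    then show ?thesis by (simp add: dot_axis)
  qed
  then have "(\<Sum>T\<in>UNIV. \<psi> (mdot X T)) = 0"
    by (intro sum_eq_0[where z = "axis i (axis j (x / X $ i $ j))" and c = x])
      (use j x in \<open>auto simp: mdot_add_right bij_plus_right\<close>)
  then show ?thesis using False by simp
qed simp

end

section \<open>Matrices of rank one and of larger rank\<close>

definition rank_one :: "('f::field ^ 'm::finite ^ 'n::finite) set" where
  "rank_one = {outer u v | u v. u \<noteq> 0 \<and> v \<noteq> 0}"

text \<open>Rank at least two is encoded by a nonzero 2 x 2 minor: minors of a difference of two
  rank-one matrices factor, and a nonzero minor directly provides two independent rows.\<close>

definition rank_gt_one :: "('f::field ^ 'm::finite ^ 'n::finite) set" where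
  "rank_gt_one = {X. \<exists>i j k l. X $ i $ k * X $ j $ l \<noteq> X $ i $ l * X $ j $ k}"

lemma rank_one_disjoint: "rank_one \<inter> rank_gt_one = {}"
  by (auto simp: rank_one_def rank_gt_one_def algebra_simps)

lemma zero_notin_rank_one: "0 \<notin> rank_one"
  by (auto simp: rank_one_def eq_commute[of 0])

lemma zero_notin_rank_gt_one: "0 \<notin> rank_gt_one"
  by (auto simp: rank_gt_one_def)

text \<open>If all 2 x 2 minors vanish, a nonzero entry \<open>X $ i $ k\<close> serves as pivot:
  row \<open>j\<close> is \<open>X $ j $ k / X $ i $ k\<close> times row \<open>i\<close>.\<close>

lemma UNIV_eq_ranks: "UNIV = insert 0 (rank_one \<union> rank_gt_one)"
proof -
  have "X \<in> rank_one" if "X \<noteq> 0" and g: "X \<notin> rank_gt_one" for X :: "'f::field ^ 'm::finite ^ 'n::finite"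
  proof -
    obtain i k where ik: "X $ i $ k \<noteq> 0" using \<open>X \<noteq> 0\<close> by (auto simp: vec_eq_iff)
    define u where "u = (\<chi> j. X $ j $ k / X $ i $ k)"
    have "X $ j $ l = u $ j * X $ i $ l" for j l
    proof -
      have "X $ i $ k * X $ j $ l = X $ i $ l * X $ j $ k"
        using g unfolding rank_gt_one_def by blast
      then show ?thesis using ik by (simp add: u_def field_simps)
    qed
    then have "X = outer u (X $ i)" unfolding vec_eq_iff outer_nth by blast
    with \<open>X \<noteq> 0\<close> have "X = outer u (X $ i) \<and> u \<noteq> 0 \<and> X $ i \<noteq> 0"
      by (metis outer_eq_0_iff)
    then show ?thesis unfolding rank_one_def by blast
  qed
  then show ?thesis by blast
qed

lemma sum_ranks:
  fixes h :: "'f::{field,finite} ^ 'm::finite ^ 'n::finite \<Rightarrow> 'a::comm_monoid_add"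
  shows "sum h UNIV = h 0 + sum h rank_one + sum h rank_gt_one"
proof -
  have "sum h UNIV = h 0 + sum h (rank_one \<union> rank_gt_one)"
    using zero_notin_rank_one zero_notin_rank_gt_one
    by (subst UNIV_eq_ranks, subst sum.insert) auto
  also have "sum h (rank_one \<union> rank_gt_one) = sum h rank_one + sum h rank_gt_one"
    by (rule sum.union_disjoint) (use rank_one_disjoint in auto)
  finally show ?thesis by (simp add: add.assoc)
qed

lemma ex_minor_ne:
  fixes x y :: "'f::field ^ 'n::finite"
  assumes "x \<noteq> 0" and "\<And>c. y \<noteq> c *s x"
  shows "\<exists>i j. x $ i * y $ j \<noteq> x $ j * y $ i"
proof (rule ccontr)
  assume *: "\<nexists>i j. x $ i * y $ j \<noteq> x $ j * y $ i"
  obtain i where i: "x $ i \<noteq> 0" using assms(1) by (auto simp: vec_eq_iff)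
  have "y = (y $ i / x $ i) *s x"
    using * i by (auto simp: vec_eq_iff field_simps)
  with assms(2) show False by blast
qed

lemma outer_eq_outerD:
  fixes u :: "'f::field ^ 'n::finite" and w :: "'f ^ 'm::finite"
  assumes eq: "outer u w = outer u0 w0" and ne: "u0 \<noteq> 0" "w0 \<noteq> 0"
  shows "\<exists>c. c \<noteq> 0 \<and> u = c *s u0 \<and> w = inverse c *s w0"
proof -
  have e: "u $ i * w $ j = u0 $ i * w0 $ j" for i j
    using arg_cong[OF eq, of "\<lambda>X. X $ i $ j"] by simp
  obtain i j where ij: "u0 $ i \<noteq> 0" "w0 $ j \<noteq> 0" using ne by (auto simp: vec_eq_iff)
  then have wj: "w $ j \<noteq> 0" using e[of i j] by auto
  define c where "c = w0 $ j / w $ j"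
  have c: "c \<noteq> 0" using ij wj by (simp add: c_def)
  have u: "u $ k = c * u0 $ k" for k using e[of k j] wj by (simp add: c_def field_simps)
  moreover have "w $ k = inverse c * w0 $ k" for k
  proof -
    have "u0 $ i * (c * w $ k) = u0 $ i * w0 $ k" using e[of i k] u[of i] by (simp add: ac_simps)
    then have "c * w $ k = w0 $ k" using ij by simp
    then have "inverse c * w0 $ k = inverse c * c * w $ k" by (simp add: mult.assoc)
    then show ?thesis using c by simp
  qed
  ultimately show ?thesis using c by (auto simp: vec_eq_iff)
qed

lemma rank_gt_one_rows:
  assumes "Y \<in> rank_gt_one"
  obtains i j where "\<And>s t. s *s (Y $ i) + t *s (Y $ j) = 0 \<Longrightarrow> s = 0 \<and> t = 0"
proof -
  obtain i j k l where m: "Y $ i $ k * Y $ j $ l \<noteq> Y $ i $ l * Y $ j $ k"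
    using assms unfolding rank_gt_one_def by blast
  have "s = 0 \<and> t = 0" if "s *s (Y $ i) + t *s (Y $ j) = 0" for s t
  proof -
    have e: "s * Y $ i $ p + t * Y $ j $ p = 0" for p
      using arg_cong[OF that, of "\<lambda>x. x $ p"] by simp
    have "s * (Y $ i $ k * Y $ j $ l - Y $ i $ l * Y $ j $ k) = 0"
      "t * (Y $ i $ k * Y $ j $ l - Y $ i $ l * Y $ j $ k) = 0"
      using e[of k] e[of l] by algebra+
    then show ?thesis using m by simp
  qed
  then show ?thesis using that by blast
qed

text \<open>The pairs giving one product are the q - 1 rescalings
  \<open>(c *s u, inverse c *s w)\<close>, and closure of \<open>W\<close> under scaling keeps all
  of them in range. Sums over rank-one directions thereby become free double sums over
  \<open>u\<close> and \<open>w\<close>.\<close>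

lemma sum_outer_image:
  fixes h :: "'f::{field,finite} ^ 'm::finite ^ 'n::finite \<Rightarrow> complex"
  assumes W: "0 \<notin> W" "\<And>c w. c \<noteq> 0 \<Longrightarrow> w \<in> W \<Longrightarrow> c *s w \<in> W"
  shows "(\<Sum>u\<in>-{0}. \<Sum>w\<in>W. h (outer u w)) =
    of_nat (CARD('f) - 1) * (\<Sum>D\<in>{outer u w | u w. u \<noteq> 0 \<and> w \<in> W}. h D)"
proof -
  let ?P = "(-{0}) \<times> W :: (('f ^ 'n) \<times> ('f ^ 'm)) set"
  let ?o = "\<lambda>(u, w). outer u w"
  have fib: "card {x \<in> ?P. ?o x = y} = CARD('f) - 1" if y: "y \<in> ?o ` ?P" for y :: "'f ^ 'm ^ 'n"
  proof -
    obtain u0 w0 where uw: "y = outer u0 w0" "u0 \<noteq> 0" "w0 \<in> W" "w0 \<noteq> 0"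
      using y W(1) by auto
    have "{x \<in> ?P. ?o x = y} = (\<lambda>c. (c *s u0, inverse c *s w0)) ` (-{0})"
    proof (intro equalityI subsetI)
      fix x assume "x \<in> {x \<in> ?P. ?o x = y}"
      then obtain u w where x: "x = (u, w)" "outer u w = outer u0 w0" using uw(1) by auto
      then show "x \<in> (\<lambda>c. (c *s u0, inverse c *s w0)) ` (-{0})"
        using outer_eq_outerD[OF x(2) uw(2,4)] by auto
    next
      fix x assume "x \<in> (\<lambda>c. (c *s u0, inverse c *s w0)) ` (-{0})"
      then obtain c where "c \<noteq> 0" "x = (c *s u0, inverse c *s w0)" by auto
      then show "x \<in> {x \<in> ?P. ?o x = y}"
        using uw W(2)[of "inverse c" w0] by (auto simp: vec_eq_iff)
    qed
    moreover have "inj_on (\<lambda>c. (c *s u0, inverse c *s w0)) (-{0})"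
      using uw(2) by (auto simp: inj_on_def vec_eq_iff)
    ultimately have "card {x \<in> ?P. ?o x = y} = card (- {0 :: 'f})"
      by (simp add: card_image)
    then show ?thesis by (simp add: Compl_eq_Diff_UNIV card_Diff_singleton)
  qed
  have img: "?o ` ?P = {outer u w | u w. u \<noteq> 0 \<and> w \<in> W}" by auto
  have "(\<Sum>u\<in>-{0}. \<Sum>w\<in>W. h (outer u w)) = (\<Sum>x\<in>?P. h (?o x))"
    by (simp add: sum.cartesian_product split_def)
  also have "\<dots> = (\<Sum>y\<in>?o ` ?P. \<Sum>x\<in>{x \<in> ?P. ?o x = y}. h (?o x))"
    by (rule sum.image_gen) simp
  also have "\<dots> = (\<Sum>y\<in>?o ` ?P. of_nat (CARD('f) - 1) * h y)"
  proof (rule sum.cong[OF refl])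
    fix y assume y: "y \<in> ?o ` ?P"
    have "(\<Sum>x\<in>{x \<in> ?P. ?o x = y}. h (?o x)) = (\<Sum>x\<in>{x \<in> ?P. ?o x = y}. h y)"
      by (rule sum.cong) auto
    also have "\<dots> = of_nat (CARD('f) - 1) * h y" using fib[OF y] by simp
    finally show "(\<Sum>x\<in>{x \<in> ?P. ?o x = y}. h (?o x)) = of_nat (CARD('f) - 1) * h y" .
  qed
  finally show ?thesis by (simp add: img sum_distrib_left)
qed

section \<open>Character sums over hyperplanes and over rank-one directions\<close>

context additive_character
begin

lemma sum_mult: "(\<Sum>s\<in>UNIV. \<psi> (s * c)) = (if c = 0 then of_nat CARD('f) else 0)"
proof (cases "c = 0")
  case False
  obtain x where x: "\<psi> x \<noteq> 1" using nontrivial by blast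
  have "(\<Sum>s\<in>UNIV. \<psi> (s * c)) = 0"
    by (rule sum_eq_0[where z = "x / c" and c = x])
      (use False x in \<open>auto simp: ring_distribs bij_plus_right\<close>)
  then show ?thesis using False by simp
qed simp

text \<open>The double sum of \<open>\<psi> (dot (s *s x + t *s y) w)\<close> over \<open>s\<close>
  and \<open>t\<close> is q^2 times the indicator of both equations. Summing over \<open>w\<close>
  first, independence leaves only the term with s = t = 0.\<close>

lemma card_two_hyperplanes:
  fixes x y :: "'f ^ 'm::finite"
  assumes ind: "\<And>s t. s *s x + t *s y = 0 \<Longrightarrow> s = 0 \<and> t = 0"
  shows "CARD('f)\<^sup>2 * card {w. dot x w = 0 \<and> dot y w = 0} = CARD('f ^ 'm)"
proof -
  have ind': "s *s x + t *s y = 0 \<longleftrightarrow> s = 0 \<and> t = 0" for s t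
    using ind by auto
  have *: "(\<Sum>s\<in>UNIV. \<Sum>t\<in>UNIV. \<psi> (dot (s *s x + t *s y) w)) =
      of_nat (CARD('f)\<^sup>2) * (if dot x w = 0 \<and> dot y w = 0 then 1 else 0)" for w
  proof -
    have "(\<Sum>s\<in>UNIV. \<Sum>t\<in>UNIV. \<psi> (dot (s *s x + t *s y) w)) =
        (\<Sum>s\<in>UNIV. \<psi> (s * dot x w)) * (\<Sum>t\<in>UNIV. \<psi> (t * dot y w))"
      by (simp add: dot_add_left dot_scale_left add sum_product)
    then show ?thesis by (simp add: sum_mult power2_eq_square)
  qed
  have "(\<Sum>w\<in>UNIV. \<Sum>s\<in>UNIV. \<Sum>t\<in>UNIV. \<psi> (dot (s *s x + t *s y) w)) =
      of_nat (CARD('f)\<^sup>2) * (\<Sum>w\<in>UNIV. if dot x w = 0 \<and> dot y w = 0 then 1 else 0)"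
    by (simp add: * sum_distrib_left)
  also have "(\<Sum>w\<in>UNIV. if dot x w = 0 \<and> dot y w = 0 then 1 else (0::complex)) =
      of_nat (card {w. dot x w = 0 \<and> dot y w = 0})"
    by (simp add: sum.If_cases)
  finally have "of_nat (CARD('f)\<^sup>2) * complex_of_nat (card {w. dot x w = 0 \<and> dot y w = 0}) =
      (\<Sum>w\<in>UNIV. \<Sum>s\<in>UNIV. \<Sum>t\<in>UNIV. \<psi> (dot (s *s x + t *s y) w))" ..
  also have "\<dots> = (\<Sum>s\<in>UNIV. \<Sum>w\<in>UNIV. \<Sum>t\<in>UNIV. \<psi> (dot (s *s x + t *s y) w))"
    by (rule sum.swap)
  also have "\<dots> = (\<Sum>s\<in>UNIV. \<Sum>t\<in>UNIV. \<Sum>w\<in>UNIV. \<psi> (dot (s *s x + t *s y) w))"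
    by (intro sum.cong refl sum.swap)
  also have "\<dots> = (\<Sum>s\<in>(UNIV::'f set). \<Sum>t\<in>(UNIV::'f set). if s = 0 then (if t = 0 then of_nat CARD('f ^ 'm) else 0) else 0)"
    by (intro sum.cong refl) (simp add: sum_dot ind')
  also have "\<dots> = (\<Sum>s\<in>(UNIV::'f set). if s = 0 then (\<Sum>t\<in>(UNIV::'f set). if t = 0 then of_nat CARD('f ^ 'm) else 0) else 0)"
    by (intro sum.cong refl) auto
  also have "\<dots> = of_nat CARD('f ^ 'm)"
    by (simp add: sum.delta)
  finally show ?thesis
    by (simp only: of_nat_mult[symmetric] of_nat_eq_iff)
qed

lemma card_hyperplane:
  fixes y :: "'f ^ 'm::finite"
  assumes "y \<noteq> 0"
  shows "CARD('f) * card {w. dot y w = 0} = CARD('f ^ 'm)"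
proof -
  have "(\<Sum>w\<in>UNIV. \<Sum>s\<in>UNIV. \<psi> (dot (s *s y) w)) =
      of_nat CARD('f) * (\<Sum>w\<in>UNIV. if dot y w = 0 then 1 else 0)"
    by (simp add: dot_scale_left sum_mult sum_distrib_left if_distrib cong: if_cong)
  also have "(\<Sum>w\<in>UNIV. if dot y w = 0 then 1 else (0::complex)) = of_nat (card {w. dot y w = 0})"
    by (simp add: sum.If_cases)
  finally have "of_nat CARD('f) * complex_of_nat (card {w. dot y w = 0}) =
      (\<Sum>w\<in>UNIV. \<Sum>s\<in>UNIV. \<psi> (dot (s *s y) w))" ..
  also have "\<dots> = (\<Sum>s\<in>UNIV. \<Sum>w\<in>UNIV. \<psi> (dot (s *s y) w))"
    by (rule sum.swap)
  also have "\<dots> = (\<Sum>s\<in>(UNIV::'f set). if s = 0 then of_nat CARD('f ^ 'm) else 0)"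
    by (intro sum.cong refl) (use assms in \<open>auto simp: sum_dot\<close>)
  also have "\<dots> = of_nat CARD('f ^ 'm)"
    by (simp add: sum.delta)
  finally show ?thesis
    by (simp only: of_nat_mult[symmetric] of_nat_eq_iff)
qed

text \<open>For fixed \<open>w\<close> the sum over all \<open>u\<close> detects
  \<open>X *v w = 0\<close>, and omitting u = 0 costs 1 per \<open>w\<close>. For \<open>W\<close>
  closed under scaling and without 0, this is q - 1 times the eigenvalue at \<open>X\<close> of the
  Cayley graph, expressed by the kernel vectors in \<open>W\<close>.\<close>

lemma sum_outer:
  fixes X :: "'f ^ 'm::finite ^ 'n::finite"
  shows "(\<Sum>u\<in>-{0}. \<Sum>w\<in>W. \<psi> (mdot X (outer u w))) =
    of_real (real CARD('f ^ 'n) * real (card {w \<in> W. X *v w = 0}) - real (card W))"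
proof -
  have *: "(\<Sum>u\<in>-{0}. \<psi> (mdot X (outer u w))) =
      (if X *v w = 0 then of_nat CARD('f ^ 'n) else 0) - 1" for w
  proof -
    have "(\<Sum>u\<in>UNIV. \<psi> (mdot X (outer u w))) = (if X *v w = 0 then of_nat CARD('f ^ 'n) else 0)"
      using sum_dot[of "X *v w"] by (simp add: mdot_commute[of X] mdot_outer dot_commute)
    moreover have "(\<Sum>u\<in>UNIV. \<psi> (mdot X (outer u w))) =
        \<psi> (mdot X (outer 0 w)) + (\<Sum>u\<in>-{0}. \<psi> (mdot X (outer u w)))"
      by (simp add: sum.remove[of UNIV 0] Compl_eq_Diff_UNIV)
    moreover have "\<psi> (mdot X (outer 0 w)) = 1"
      by (simp add: mdot_commute[of X] mdot_outer)
    ultimately show ?thesis by (simp add: algebra_simps)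
  qed
  have "(\<Sum>u\<in>-{0}. \<Sum>w\<in>W. \<psi> (mdot X (outer u w))) =
      (\<Sum>w\<in>W. \<Sum>u\<in>-{0}. \<psi> (mdot X (outer u w)))"
    by (rule sum.swap)
  also have "\<dots> = (\<Sum>w\<in>W. if X *v w = 0 then of_nat CARD('f ^ 'n) else 0) - of_nat (card W)"
    by (simp add: * sum_subtractf)
  also have "(\<Sum>w\<in>W. if X *v w = 0 then complex_of_nat CARD('f ^ 'n) else 0) =
      of_nat CARD('f ^ 'n) * of_nat (card {w \<in> W. X *v w = 0})"
    by (simp add: sum.If_cases Int_def)
  finally show ?thesis by simp
qed

end

section \<open>Fourier analysis and edge expansion\<close>

context additive_character
begin

text \<open>The unnormalised transform of the indicator of \<open>S\<close>; Parseval accordingly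
  carries the number of matrices as a factor.\<close>

definition fourier :: "('f ^ 'm::finite ^ 'n::finite) set \<Rightarrow> 'f ^ 'm ^ 'n \<Rightarrow> complex" where
  "fourier S X = (\<Sum>T\<in>S. \<psi> (mdot X T))"

lemma fourier_0 [simp]: "fourier S 0 = of_nat (card S)"
  by (simp add: fourier_def)

text \<open>Expanding the square gives a sum over \<open>T\<close> and \<open>T'\<close> in
  \<open>S\<close> in which orthogonality keeps only \<open>T' = T + D\<close>. With D = 0 this is
  Parseval; summed over edge directions it counts the edges inside \<open>S\<close>.\<close>

lemma fourier_correlation:
  fixes S :: "('f ^ 'm::finite ^ 'n::finite) set"
  shows "(\<Sum>X\<in>UNIV. of_real ((norm (fourier S X))\<^sup>2) * \<psi> (mdot X D)) =
    of_nat (CARD('f ^ 'm ^ 'n) * card {T \<in> S. T + D \<in> S})"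
proof -
  let ?N = "CARD('f ^ 'm ^ 'n)"
  have "(\<Sum>X\<in>UNIV. of_real ((norm (fourier S X))\<^sup>2) * \<psi> (mdot X D)) =
      (\<Sum>X\<in>UNIV. \<Sum>T\<in>S. \<Sum>T'\<in>S. \<psi> (mdot (T + D - T') X))"
  proof (rule sum.cong[OF refl])
    fix X :: "'f ^ 'm ^ 'n"
    have "of_real ((norm (fourier S X))\<^sup>2) * \<psi> (mdot X D) =
        (fourier S X * \<psi> (mdot X D)) * cnj (fourier S X)"
      using complex_norm_square[of "fourier S X"] by (simp add: ac_simps)
    also have "\<dots> = (\<Sum>T\<in>S. \<Sum>T'\<in>S. \<psi> (mdot X T) * \<psi> (mdot X D) * cnj (\<psi> (mdot X T')))"
      unfolding fourier_def cnj_sum sum_distrib_right[of _ _ "\<psi> (mdot X D)"] sum_product ..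
    finally show "of_real ((norm (fourier S X))\<^sup>2) * \<psi> (mdot X D) =
        (\<Sum>T\<in>S. \<Sum>T'\<in>S. \<psi> (mdot (T + D - T') X))"
      by (simp add: mdot_commute[of _ X] mdot_diff_right mdot_add_right diff add)
  qed
  also have "\<dots> = (\<Sum>T\<in>S. \<Sum>X\<in>UNIV. \<Sum>T'\<in>S. \<psi> (mdot (T + D - T') X))"
    by (rule sum.swap)
  also have "\<dots> = (\<Sum>T\<in>S. \<Sum>T'\<in>S. \<Sum>X\<in>UNIV. \<psi> (mdot (T + D - T') X))"
    by (intro sum.cong refl sum.swap)
  also have "\<dots> = (\<Sum>T\<in>S. \<Sum>T'\<in>S. if T + D = T' then of_nat ?N else 0)"
    by (simp add: sum_mdot)
  also have "\<dots> = (\<Sum>T\<in>S. if T + D \<in> S then of_nat ?N else 0)"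
    by (simp add: sum.delta)
  also have "\<dots> = of_nat (?N * card {T \<in> S. T + D \<in> S})"
    by (simp add: sum.If_cases Int_def)
  finally show ?thesis .
qed

lemma parseval:
  fixes S :: "('f ^ 'm::finite ^ 'n::finite) set"
  shows "(real (card S))\<^sup>2 + (\<Sum>X\<in>rank_one. (norm (fourier S X))\<^sup>2) +
    (\<Sum>X\<in>rank_gt_one. (norm (fourier S X))\<^sup>2) = real CARD('f ^ 'm ^ 'n) * real (card S)"
proof -
  have "complex_of_real (\<Sum>X\<in>UNIV. (norm (fourier S X))\<^sup>2) =
      of_real (real CARD('f ^ 'm ^ 'n) * real (card S))"
    using fourier_correlation[of S 0] by simp
  then have "(\<Sum>X\<in>UNIV. (norm (fourier S X))\<^sup>2) = real CARD('f ^ 'm ^ 'n) * real (card S)"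
    by (simp only: of_real_eq_iff)
  then show ?thesis by (simp add: sum_ranks)
qed

lemma card_kernel_le:
  fixes X :: "'f ^ 'm::finite ^ 'n::finite"
  shows "X \<in> rank_one \<Longrightarrow> CARD('f) * card {w. X *v w = 0} \<le> CARD('f ^ 'm)"
    and "X \<in> rank_gt_one \<Longrightarrow> CARD('f)\<^sup>2 * card {w. X *v w = 0} \<le> CARD('f ^ 'm)"
proof -
  have row: "dot (X $ i) w = 0" if "X *v w = 0" for i w
    using arg_cong[OF that, of "\<lambda>x. x $ i"] by (simp add: dot_def matrix_vector_mult_def)
  show "CARD('f) * card {w. X *v w = 0} \<le> CARD('f ^ 'm)" if X: "X \<in> rank_one"
  proof -
    obtain i where i: "X $ i \<noteq> 0"
      using X zero_notin_rank_one by (metis vec_eq_iff zero_index)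
    have "card {w. X *v w = 0} \<le> card {w. dot (X $ i) w = 0}"
      by (rule card_mono) (auto simp: row)
    from mult_le_mono2[OF this, of "CARD('f)"] show ?thesis
      using card_hyperplane[OF i] by linarith
  qed
  show "CARD('f)\<^sup>2 * card {w. X *v w = 0} \<le> CARD('f ^ 'm)" if X: "X \<in> rank_gt_one"
  proof -
    obtain i j where ij: "\<And>s t. s *s (X $ i) + t *s (X $ j) = 0 \<Longrightarrow> s = 0 \<and> t = 0"
      using rank_gt_one_rows[OF X] by metis
    have "card {w. X *v w = 0} \<le> card {w. dot (X $ i) w = 0 \<and> dot (X $ j) w = 0}"
      by (rule card_mono) (auto simp: row)
    from mult_le_mono2[OF this, of "CARD('f)\<^sup>2"] show ?thesis
      using card_two_hyperplanes[of "X $ i" "X $ j", OF ij] by linarith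
  qed
qed

text \<open>\<open>Gen\<close> is the connection set of a Cayley graph with eigenvalues
  \<open>k X\<close> and degree \<open>k 0\<close>. As \<open>k X \<le> k 0 / q\<close> on rank one
  and \<open>k X \<le> k 0 / q\<^sup>2\<close> above, the edge count gives N s \<le> q s^2 + E1 + E2
  / q, where E1 and E2 are the energies on rank one and above. Parseval gives N s = s^2 + E1 + E2,
  and subtracting cancels E1.\<close>

lemma rank_gt_one_energy_le:
  fixes S :: "('f ^ 'm::finite ^ 'n::finite) set" and W :: "('f ^ 'm) set"
  defines "Gen \<equiv> {outer u w | u w. u \<noteq> (0 :: 'f ^ 'n) \<and> w \<in> W}"
  assumes W: "0 \<notin> W" "\<And>c w. c \<noteq> 0 \<Longrightarrow> w \<in> W \<Longrightarrow> c *s w \<in> W"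
    and card_W: "card W + CARD('f) = CARD('f ^ 'm)" and "W \<noteq> {}"
    and exp: "real (card S) * real (card Gen) \<le>
      real CARD('f) * (\<Sum>D\<in>Gen. real (card {T \<in> S. T + D \<in> S}))"
  shows "(\<Sum>X\<in>rank_gt_one. (norm (fourier S X))\<^sup>2) \<le> real CARD('f) * (real (card S))\<^sup>2"
proof -
  define q where "q = real CARD('f)"
  define N where "N = real CARD('f ^ 'm ^ 'n)"
  define s where "s = real (card S)"
  define e where "e X = (norm (fourier S X))\<^sup>2" for X
  define k where "k X = (real CARD('f ^ 'n) * real (card {w \<in> W. X *v w = 0}) - real (card W)) / (q - 1)"
    for X :: "'f ^ 'm ^ 'n"
  have card_ge_2: "CARD('f) \<ge> 2"
    using card_mono[of UNIV "{0, 1 :: 'f}"] by simp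
  then have q: "q \<ge> 2" by (simp add: q_def)
  have Gen_sum: "(\<Sum>D\<in>Gen. \<psi> (mdot X D)) = of_real (k X)" for X
  proof -
    have "of_nat (CARD('f) - 1) = complex_of_real (q - 1)"
      using card_ge_2 by (simp add: q_def of_nat_diff)
    then have "of_real (q - 1) * (\<Sum>D\<in>Gen. \<psi> (mdot X D)) = of_real ((q - 1) * k X)"
      using sum_outer_image[OF W, of "\<lambda>D. \<psi> (mdot X D)"] sum_outer[of X W] q
      unfolding Gen_def k_def by simp
    then have "of_real (q - 1) * (\<Sum>D\<in>Gen. \<psi> (mdot X D)) = of_real (q - 1) * of_real (k X)"
      by simp
    moreover have "complex_of_real (q - 1) \<noteq> 0" using q by (simp only: of_real_eq_0_iff)
    ultimately show ?thesis using mult_left_cancel by blast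
  qed
  have k0: "k 0 = real (card Gen)"
  proof -
    have "complex_of_real (k 0) = of_real (real (card Gen))" using Gen_sum[of 0] by simp
    then show ?thesis by (simp only: of_real_eq_iff)
  qed
  have Gen0: "k 0 = (real CARD('f ^ 'n) - 1) * real (card W) / (q - 1)"
    by (simp add: k_def algebra_simps)
  have bound: "k X \<le> k 0 / q ^ r" if "q ^ r * real (card {w \<in> W. X *v w = 0}) \<le> real (card W)" for X r
  proof -
    have qr: "1 \<le> q ^ r" using q by (simp add: one_le_power)
    have "q ^ r * (real CARD('f ^ 'n) * real (card {w \<in> W. X *v w = 0}) - real (card W)) \<le>
        real CARD('f ^ 'n) * real (card W) - q ^ r * real (card W)"
      using mult_left_mono[OF that, of "real CARD('f ^ 'n)"] by (simp add: algebra_simps)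
    also have "\<dots> \<le> (real CARD('f ^ 'n) - 1) * real (card W)"
      using mult_right_mono[OF qr, of "real (card W)"] by (simp add: algebra_simps)
    finally have "q ^ r * ((q - 1) * k X) \<le> (q - 1) * k 0"
      using q unfolding Gen0 by (simp add: k_def)
    then have "(q - 1) * (q ^ r * k X) \<le> (q - 1) * k 0" by (simp add: ac_simps)
    then have "q ^ r * k X \<le> k 0" using q by (simp add: mult_le_cancel_left)
    then show ?thesis using qr by (simp add: field_simps)
  qed
  \<comment> \<open>The kernel contains 0 and \<open>W\<close> does not. This spare vector,
    multiplied by q or q^2, absorbs the \<open>CARD('f)\<close> by which \<open>card W\<close> falls
    short of the whole space.\<close>
  have less: "card {w \<in> W. X *v w = 0} + 1 \<le> card {w. X *v w = 0}" for X :: "'f ^ 'm ^ 'n"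
  proof -
    have "0 \<in> {w. X *v w = 0}" "0 \<notin> {w \<in> W. X *v w = 0}" using W(1) by auto
    then have "{w \<in> W. X *v w = 0} \<subset> {w. X *v w = 0}" by blast
    then have "card {w \<in> W. X *v w = 0} < card {w. X *v w = 0}" by (rule psubset_card_mono[OF finite])
    then show ?thesis by simp
  qed
  have k1: "k X \<le> k 0 / q" if "X \<in> rank_one" for X
  proof -
    have "CARD('f) * (card {w \<in> W. X *v w = 0} + 1) \<le> card W + CARD('f)"
      using card_kernel_le(1)[OF that] mult_le_mono2[OF less[of X], of "CARD('f)"] card_W by linarith
    then have "CARD('f) * card {w \<in> W. X *v w = 0} \<le> card W" by simp
    from of_nat_mono[OF this, where 'a = real]
    have "q * real (card {w \<in> W. X *v w = 0}) \<le> real (card W)" by (simp add: q_def)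
    then show ?thesis using bound[of 1 X] by simp
  qed
  have k2: "k X \<le> k 0 / q\<^sup>2" if "X \<in> rank_gt_one" for X
  proof -
    have "CARD('f)\<^sup>2 * (card {w \<in> W. X *v w = 0} + 1) \<le> card W + CARD('f)"
      using card_kernel_le(2)[OF that] mult_le_mono2[OF less[of X], of "CARD('f)\<^sup>2"] card_W by linarith
    moreover have "CARD('f) \<le> CARD('f)\<^sup>2" by (simp add: power2_eq_square)
    ultimately have "CARD('f)\<^sup>2 * card {w \<in> W. X *v w = 0} \<le> card W" by simp
    from of_nat_mono[OF this, where 'a = real]
    have "q\<^sup>2 * real (card {w \<in> W. X *v w = 0}) \<le> real (card W)" by (simp add: q_def)
    then show ?thesis by (rule bound)
  qed
  have "complex_of_real (\<Sum>X\<in>UNIV. e X * k X) = (\<Sum>X\<in>UNIV. of_real (e X) * (\<Sum>D\<in>Gen. \<psi> (mdot X D)))"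
    by (simp add: Gen_sum)
  also have "\<dots> = (\<Sum>D\<in>Gen. \<Sum>X\<in>UNIV. of_real (e X) * \<psi> (mdot X D))"
    unfolding sum_distrib_left by (rule sum.swap)
  also have "\<dots> = of_real (N * (\<Sum>D\<in>Gen. real (card {T \<in> S. T + D \<in> S})))"
    unfolding e_def fourier_correlation by (simp add: N_def sum_distrib_left)
  finally have "(\<Sum>X\<in>UNIV. e X * k X) = N * (\<Sum>D\<in>Gen. real (card {T \<in> S. T + D \<in> S}))"
    by (simp only: of_real_eq_iff)
  moreover have "s * k 0 \<le> q * (\<Sum>D\<in>Gen. real (card {T \<in> S. T + D \<in> S}))"
    using exp by (simp add: k0 s_def q_def)
  ultimately have "N * s * k 0 \<le> q * (\<Sum>X\<in>UNIV. e X * k X)"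
    by (simp add: N_def ac_simps)
  also have "(\<Sum>X\<in>UNIV. e X * k X) \<le>
      e 0 * k 0 + (\<Sum>X\<in>rank_one. e X * (k 0 / q)) + (\<Sum>X\<in>rank_gt_one. e X * (k 0 / q\<^sup>2))"
    unfolding sum_ranks
    by (intro add_mono sum_mono mult_left_mono order_refl k1 k2) (auto simp: e_def)
  also have "\<dots> = (e 0 + sum e rank_one / q + sum e rank_gt_one / q\<^sup>2) * k 0"
    by (simp add: sum_distrib_right[symmetric] sum_divide_distrib[symmetric] ring_distribs)
  finally have main: "N * s * k 0 \<le> q * (e 0 + sum e rank_one / q + sum e rank_gt_one / q\<^sup>2) * k 0"
    using q by (simp add: mult.assoc)
  have "k 0 > 0"
  proof -
    obtain w where "w \<in> W" using \<open>W \<noteq> {}\<close> by blast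
    moreover have "(1 :: 'f ^ 'n) \<noteq> 0" by simp
    ultimately have "outer 1 w \<in> Gen" unfolding Gen_def by blast
    then show ?thesis unfolding k0 by (auto simp: card_gt_0_iff)
  qed
  with main have "N * s \<le> q * (e 0 + sum e rank_one / q + sum e rank_gt_one / q\<^sup>2)"
    by (simp add: mult_le_cancel_right)
  also have "\<dots> = q * e 0 + sum e rank_one + sum e rank_gt_one / q"
    using q by (simp add: ring_distribs power2_eq_square)
  finally have "s\<^sup>2 + sum e rank_one + sum e rank_gt_one \<le> q * s\<^sup>2 + sum e rank_one + sum e rank_gt_one / q"
    using parseval[of S] by (simp add: e_def N_def s_def)
  then have "sum e rank_gt_one * (q - 1) \<le> q * s\<^sup>2 * (q - 1)"
    using q by (simp add: field_simps)
  then have "sum e rank_gt_one \<le> q * s\<^sup>2"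
    using q by (simp add: mult_le_cancel_right)
  then show ?thesis by (simp add: e_def q_def s_def)
qed

end

section \<open>Pairs of rank-one matrices\<close>

text \<open>Kernels act as labels: for a rank-one matrix \<open>outer u v\<close> the kernel is the
  orthogonal complement of \<open>v\<close>, which names the line through \<open>v\<close> without a
  choice of representative. \<open>left_ker\<close> does the same for \<open>u\<close>.\<close>

definition ker :: "'f::field ^ 'm::finite ^ 'n::finite \<Rightarrow> ('f ^ 'm) set" where
  "ker X = {w. X *v w = 0}"

definition left_ker :: "'f::field ^ 'm::finite ^ 'n::finite \<Rightarrow> ('f ^ 'n) set" where
  "left_ker X = {w. w v* X = 0}"

lemma ker_outer: "u \<noteq> 0 \<Longrightarrow> ker (outer u v) = {w. dot v w = 0}"
  by (auto simp: ker_def outer_mult_vec vec_eq_iff)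

lemma left_ker_outer: "v \<noteq> 0 \<Longrightarrow> left_ker (outer u v) = {w. dot u w = 0}"
  by (auto simp: left_ker_def vec_mult_outer vec_eq_iff dot_commute)

lemma perp_eq_imp_parallel:
  fixes v :: "'f::field ^ 'm::finite"
  assumes "v \<noteq> 0" and eq: "{w. dot v w = 0} = {w. dot v' w = 0}"
  shows "\<exists>c. v' = c *s v"
proof (rule ccontr)
  assume "\<nexists>c. v' = c *s v"
  then obtain k l where kl: "v $ k * v' $ l \<noteq> v $ l * v' $ k"
    using ex_minor_ne[OF assms(1), of v'] by blast
  \<comment> \<open>Orthogonal to \<open>v\<close> by construction, while its pairing with
    \<open>v'\<close> is the nonzero 2 x 2 minor.\<close>
  define w where "w = axis l (v $ k) - axis k (v $ l)"
  have "dot v w = 0" by (simp add: w_def dot_diff_right dot_axis)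
  moreover have "dot v' w \<noteq> 0"
    using kl by (simp add: w_def dot_diff_right dot_axis mult.commute)
  ultimately show False using eq by blast
qed

lemma perp_scale: "c \<noteq> 0 \<Longrightarrow> {w. dot (c *s v) w = 0} = {w. dot v w = 0}"
  by (simp add: dot_scale_left)

definition transversal :: "(('f::field ^ 'm::finite ^ 'n::finite) \<times> ('f ^ 'm ^ 'n)) set" where
  "transversal = {(X, X') \<in> rank_one \<times> rank_one. ker X \<noteq> ker X' \<and> left_ker X \<noteq> left_ker X'}"

lemma transversal_outer:
  assumes "(X, X') \<in> transversal" "X = outer u v" "X' = outer u' v'"
  shows "u \<noteq> 0" "v \<noteq> 0" "v' \<noteq> c *s v" "u' \<noteq> c *s u"
proof -
  have X: "X \<noteq> 0" "X' \<noteq> 0" and k: "ker X \<noteq> ker X'" "left_ker X \<noteq> left_ker X'"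
    using assms(1) zero_notin_rank_one unfolding transversal_def by auto
  have ne: "u \<noteq> 0" "v \<noteq> 0" "u' \<noteq> 0" "v' \<noteq> 0"
    using X assms(2,3) by auto
  then show "u \<noteq> 0" "v \<noteq> 0" by auto
  show "v' \<noteq> c *s v"
  proof
    assume v': "v' = c *s v"
    then have "c \<noteq> 0" using ne by auto
    then show False using k(1) ne assms(2,3) by (simp add: ker_outer v' perp_scale)
  qed
  show "u' \<noteq> c *s u"
  proof
    assume u': "u' = c *s u"
    then have "c \<noteq> 0" using ne by auto
    then show False using k(2) ne assms(2,3) by (simp add: left_ker_outer u' perp_scale)
  qed
qed

lemma transversal_rank_gt_one:
  assumes "(X, X') \<in> transversal"
  shows "X - X' \<in> rank_gt_one"
proof -
  obtain u v u' v' where X: "X = outer u v" "X' = outer u' v'"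
    using assms unfolding transversal_def rank_one_def by auto
  note t = transversal_outer[OF assms X]
  obtain i j where ij: "u $ i * u' $ j \<noteq> u $ j * u' $ i" using ex_minor_ne[OF t(1,4)] by blast
  obtain k l where kl: "v $ k * v' $ l \<noteq> v $ l * v' $ k" using ex_minor_ne[OF t(2,3)] by blast
  \<comment> \<open>An instance of Cauchy-Binet: up to sign, the minor of the difference is the
    product of a minor of \<open>u\<close>, \<open>u'\<close> and a minor of \<open>v\<close>,
    \<open>v'\<close>.\<close>
  have "(X - X') $ i $ l * (X - X') $ j $ k - (X - X') $ i $ k * (X - X') $ j $ l =
      (u $ i * u' $ j - u $ j * u' $ i) * (v $ k * v' $ l - v $ l * v' $ k)"
    by (simp add: X algebra_simps)
  moreover have "\<dots> \<noteq> 0" using ij kl by simp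
  ultimately have "(X - X') $ i $ k * (X - X') $ j $ l \<noteq> (X - X') $ i $ l * (X - X') $ j $ k"
    by (metis eq_iff_diff_eq_0)
  then show ?thesis unfolding rank_gt_one_def by blast
qed

text \<open>If Y = u v^T - u' v'^T for a transversal pair, then \<open>v\<close> and
  \<open>v'\<close> lie in the span \<open>L\<close> of two independent rows of \<open>Y\<close>,
  which leaves at most q^2 choices for each. As \<open>v\<close> and \<open>v'\<close> are
  independent, they and \<open>Y\<close> determine \<open>u\<close> and \<open>u'\<close>.\<close>

lemma card_transversal_le:
  fixes Y :: "'f::{field,finite} ^ 'm::finite ^ 'n::finite"
  shows "card {x \<in> transversal. fst x - snd x = Y} \<le> CARD('f) ^ 4"
proof (cases "Y \<in> rank_gt_one")
  case False
  then have "{x \<in> transversal. fst x - snd x = Y} = {}"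
    using transversal_rank_gt_one by fastforce
  then show ?thesis by (metis card.empty le0)
next
  case True
  obtain i j where ind: "\<And>s t. s *s (Y $ i) + t *s (Y $ j) = 0 \<Longrightarrow> s = 0 \<and> t = 0"
    using rank_gt_one_rows[OF True] by metis
  define L where "L = (\<lambda>(s, t). s *s (Y $ i) + t *s (Y $ j)) ` (UNIV :: ('f \<times> 'f) set)"
  have L_mem: "s *s (Y $ i) + t *s (Y $ j) \<in> L" for s t
    unfolding L_def by (rule image_eqI[of _ _ "(s, t)"]) auto
  have "card L \<le> CARD('f \<times> 'f)" unfolding L_def by (rule card_image_le) simp
  then have card_L: "card L \<le> CARD('f) * CARD('f)" by simp
  obtain uu :: "'f ^ 'm ^ 'n \<Rightarrow> 'f ^ 'n" and vv :: "'f ^ 'm ^ 'n \<Rightarrow> 'f ^ 'm"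
    where rep: "\<And>X. X \<in> rank_one \<Longrightarrow> X = outer (uu X) (vv X)"
  proof -
    have "\<forall>X\<in>rank_one. \<exists>p. X = outer (fst p :: 'f ^ 'n) (snd p :: 'f ^ 'm)"
      unfolding rank_one_def by auto
    then obtain p where "\<forall>X\<in>rank_one. X = outer (fst (p X) :: 'f ^ 'n) (snd (p X) :: 'f ^ 'm)" by metis
    then show ?thesis using that[of "fst \<circ> p" "snd \<circ> p"] by auto
  qed
  let ?A = "{x \<in> transversal. fst x - snd x = Y}"
  let ?g = "\<lambda>x. (vv (fst x), vv (snd x))"
  have in_L: "vv X \<in> L \<and> vv X' \<in> L" if tr: "(X, X') \<in> transversal" and Y: "X - X' = Y" for X X'
  proof -
    define u v u' v' where uv: "u = uu X" "v = vv X" "u' = uu X'" "v' = vv X'"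
    have X: "X = outer u v" "X' = outer u' v'"
      using tr rep unfolding uv transversal_def by auto
    have row: "Y $ k = u $ k *s v - u' $ k *s v'" for k
      using Y X by (auto simp: vec_eq_iff)
    \<comment> \<open>The determinant of Cramer's rule for recovering \<open>v\<close> and
      \<open>v'\<close> from rows \<open>i\<close> and \<open>j\<close>. If it vanished,
      independence of the two rows would force \<open>u $ i\<close> and \<open>u' $ i\<close>, hence
      row \<open>i\<close> itself, to be zero.\<close>
    define \<Delta> where "\<Delta> = u $ i * u' $ j - u $ j * u' $ i"
    have 1: "(u' $ j) *s (Y $ i) + (- (u' $ i)) *s (Y $ j) = \<Delta> *s v"
      and 2: "(u $ j) *s (Y $ i) + (- (u $ i)) *s (Y $ j) = \<Delta> *s v'"
      unfolding row \<Delta>_def by (auto simp: vec_eq_iff algebra_simps)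
    have "\<Delta> \<noteq> 0"
    proof
      assume "\<Delta> = 0"
      then have "u $ i = 0" "u' $ i = 0" using ind[OF 1[THEN trans]] ind[OF 2[THEN trans]] by auto
      then have "1 *s (Y $ i) + 0 *s (Y $ j) = 0" unfolding row by simp
      from ind[OF this] show False by simp
    qed
    then have "v = (1 / \<Delta>) *s (\<Delta> *s v)" "v' = (1 / \<Delta>) *s (\<Delta> *s v')" by (auto simp: vec_eq_iff)
    then have "v = (u' $ j / \<Delta>) *s (Y $ i) + (- (u' $ i) / \<Delta>) *s (Y $ j)"
      "v' = (u $ j / \<Delta>) *s (Y $ i) + (- (u $ i) / \<Delta>) *s (Y $ j)"
      unfolding 1[symmetric] 2[symmetric] by (auto simp: vec_eq_iff algebra_simps)
    then have "v \<in> L" "v' \<in> L" using L_mem by metis+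
    then show ?thesis by (simp add: uv)
  qed
  have inj: "inj_on ?g ?A"
  proof (rule inj_onI)
    fix x z assume x: "x \<in> ?A" and z: "z \<in> ?A" and g: "?g x = ?g z"
    obtain X X' Z Z' where xz: "x = (X, X')" "z = (Z, Z')" by (metis surj_pair)
    define u v u' v' a a' where uv: "u = uu X" "v = vv X" "u' = uu X'" "v' = vv X'"
      "a = uu Z" "a' = uu Z'"
    have X: "X = outer u v" "X' = outer u' v'" "Z = outer a v" "Z' = outer a' v'"
      using x z g rep[of X] rep[of X'] rep[of Z] rep[of Z'] unfolding uv transversal_def xz by auto
    have tr: "(X, X') \<in> transversal" and "X - X' = Z - Z'" using x z xz by auto
    note t = transversal_outer[OF tr X(1,2)]
    have e: "(u $ k - a $ k) * v $ l = (u' $ k - a' $ k) * v' $ l" for k l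
      using arg_cong[OF \<open>X - X' = Z - Z'\<close>, of "\<lambda>M. M $ k $ l"] unfolding X by (simp add: algebra_simps)
    have "u' $ k = a' $ k" for k
    proof (rule ccontr)
      assume "u' $ k \<noteq> a' $ k"
      then have "v' $ l = (u $ k - a $ k) / (u' $ k - a' $ k) * v $ l" for l
        using e[of k l] by (simp add: divide_simps ac_simps)
      then have "v' = ((u $ k - a $ k) / (u' $ k - a' $ k)) *s v"
        unfolding vec_eq_iff vector_smult_component by blast
      then show False using t(3) by blast
    qed
    moreover obtain l where "v $ l \<noteq> 0" using t(2) by (auto simp: vec_eq_iff)
    ultimately have "u = a" "u' = a'" using e[of _ l] by (auto simp: vec_eq_iff)
    then show "x = z" unfolding xz X by simp
  qed
  have "?g ` ?A \<subseteq> L \<times> L" using in_L by auto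
  then have "card (?g ` ?A) \<le> card (L \<times> L)" by (rule card_mono[OF finite])
  also have "\<dots> \<le> (CARD('f) * CARD('f)) * (CARD('f) * CARD('f))"
    unfolding card_cartesian_product by (rule mult_le_mono[OF card_L card_L])
  finally show ?thesis by (simp add: card_image[OF inj] power4_eq_xxxx mult.assoc)
qed

text \<open>The fibres of \<open>\<kappa>\<close> will be zoom sets and \<open>h\<close> a squared
  character sum that is constant on them, so the density bound applies fibre by fibre.\<close>

lemma sum_le_by_fibers:
  fixes h :: "'v::finite \<Rightarrow> real"
  assumes const: "\<And>T T'. \<kappa> T = \<kappa> T' \<Longrightarrow> h T = h T'" and nonneg: "\<And>T. 0 \<le> h T"
    and dens: "\<And>b. real (card {T \<in> S. \<kappa> T = b}) \<le> p * real (card {T. \<kappa> T = b})"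
  shows "sum h S \<le> p * sum h UNIV"
proof -
  have fib: "sum h A = (\<Sum>b\<in>range \<kappa>. real (card {T \<in> A. \<kappa> T = b}) * h (inv \<kappa> b))" for A
  proof -
    have "sum h A = (\<Sum>b\<in>range \<kappa>. \<Sum>T\<in>{T \<in> A. \<kappa> T = b}. h T)"
      by (rule sum.group[symmetric]) auto
    also have "\<dots> = (\<Sum>b\<in>range \<kappa>. \<Sum>T\<in>{T \<in> A. \<kappa> T = b}. h (inv \<kappa> b))"
      by (intro sum.cong refl const) (auto simp: f_inv_into_f)
    finally show ?thesis by simp
  qed
  have "sum h S \<le> (\<Sum>b\<in>range \<kappa>. (p * real (card {T. \<kappa> T = b})) * h (inv \<kappa> b))"
    unfolding fib[of S] by (intro sum_mono mult_right_mono dens nonneg)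
  also have "\<dots> = p * sum h UNIV"
    unfolding fib[of UNIV] by (simp add: sum_distrib_left mult.assoc)
  finally show ?thesis .
qed

text \<open>Within each class of \<open>\<pi>\<close> the double sum factors into a number and its
  conjugate. In particular the whole sum is real and nonnegative for any labelling.\<close>

lemma sum_equivalent_pairs:
  fixes t :: "'i \<Rightarrow> complex"
  assumes "finite I"
  shows "(\<Sum>(i, j)\<in>{(i, j) \<in> I \<times> I. \<pi> i = \<pi> j}. t i * cnj (t j)) =
    of_real (\<Sum>c\<in>\<pi> ` I. (norm (\<Sum>i\<in>{i \<in> I. \<pi> i = c}. t i))\<^sup>2)"
proof -
  have "{(i, j) \<in> I \<times> I. \<pi> i = \<pi> j} = Sigma I (\<lambda>i. {j \<in> I. \<pi> j = \<pi> i})" by auto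
  then have "(\<Sum>(i, j)\<in>{(i, j) \<in> I \<times> I. \<pi> i = \<pi> j}. t i * cnj (t j)) =
      (\<Sum>i\<in>I. \<Sum>j\<in>{j \<in> I. \<pi> j = \<pi> i}. t i * cnj (t j))"
    using assms by (simp add: sum.Sigma)
  also have "\<dots> = (\<Sum>c\<in>\<pi> ` I. \<Sum>i\<in>{i \<in> I. \<pi> i = c}. \<Sum>j\<in>{j \<in> I. \<pi> j = \<pi> i}. t i * cnj (t j))"
    by (rule sum.image_gen[OF assms])
  also have "\<dots> = (\<Sum>c\<in>\<pi> ` I. \<Sum>i\<in>{i \<in> I. \<pi> i = c}. \<Sum>j\<in>{j \<in> I. \<pi> j = c}. t i * cnj (t j))"
    by (intro sum.cong refl) auto
  also have "\<dots> = (\<Sum>c\<in>\<pi> ` I. of_real ((norm (\<Sum>i\<in>{i \<in> I. \<pi> i = c}. t i))\<^sup>2))"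
    by (rule sum.cong[OF refl]) (simp only: complex_norm_square cnj_sum sum_product)
  finally show ?thesis by simp
qed

section \<open>The energy of the rank-one part\<close>

context additive_character
begin

lemma plancherel:
  fixes A :: "('f ^ 'm::finite ^ 'n::finite) set"
  shows "(\<Sum>T\<in>UNIV. (norm (\<Sum>X\<in>A. c X * \<psi> (mdot X T)))\<^sup>2) =
    real CARD('f ^ 'm ^ 'n) * (\<Sum>X\<in>A. (norm (c X))\<^sup>2)"
proof -
  let ?N = "complex_of_real (real CARD('f ^ 'm ^ 'n))"
  have "complex_of_real (\<Sum>T\<in>UNIV. (norm (\<Sum>X\<in>A. c X * \<psi> (mdot X T)))\<^sup>2) =
      (\<Sum>T\<in>UNIV. \<Sum>X\<in>A. \<Sum>X'\<in>A. (c X * \<psi> (mdot X T)) * cnj (c X' * \<psi> (mdot X' T)))"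
    by (simp only: of_real_sum complex_norm_square cnj_sum sum_product)
  also have "\<dots> = (\<Sum>T\<in>UNIV. \<Sum>X\<in>A. \<Sum>X'\<in>A. c X * cnj (c X') * \<psi> (mdot (X - X') T))"
    by (simp add: mdot_diff_left diff ac_simps)
  also have "\<dots> = (\<Sum>X\<in>A. \<Sum>T\<in>UNIV. \<Sum>X'\<in>A. c X * cnj (c X') * \<psi> (mdot (X - X') T))"
    by (rule sum.swap)
  also have "\<dots> = (\<Sum>X\<in>A. \<Sum>X'\<in>A. \<Sum>T\<in>UNIV. c X * cnj (c X') * \<psi> (mdot (X - X') T))"
    by (intro sum.cong refl sum.swap)
  also have "\<dots> = (\<Sum>X\<in>A. \<Sum>X'\<in>A. if X = X' then c X * cnj (c X') * ?N else 0)"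
    unfolding sum_distrib_left[symmetric] sum_mdot by (intro sum.cong refl) auto
  also have "\<dots> = (\<Sum>X\<in>A. c X * cnj (c X) * ?N)"
    by (intro sum.cong refl) (simp add: sum.delta)
  also have "\<dots> = of_real (real CARD('f ^ 'm ^ 'n) * (\<Sum>X\<in>A. (norm (c X))\<^sup>2))"
    by (simp only: of_real_sum of_real_mult complex_norm_square sum_distrib_left mult.commute)
  finally show ?thesis by (simp only: of_real_eq_iff)
qed

text \<open>Over all matrices, \<open>plancherel\<close> turns the second moment of a class sum into
  the energy of its coefficients. The classes partition \<open>I\<close>, so a factor
  \<open>p\<close> in each class gives the same factor for all of them together.\<close>

lemma sum_classes_le:
  fixes S I :: "('f ^ 'm::finite ^ 'n::finite) set"
  assumes "\<And>a. a \<in> \<pi> ` I \<Longrightarrow>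
    (\<Sum>T\<in>S. (norm (\<Sum>X\<in>{X \<in> I. \<pi> X = a}. c X * \<psi> (mdot X T)))\<^sup>2) \<le>
    p * (\<Sum>T\<in>UNIV. (norm (\<Sum>X\<in>{X \<in> I. \<pi> X = a}. c X * \<psi> (mdot X T)))\<^sup>2)"
  shows "(\<Sum>T\<in>S. \<Sum>a\<in>\<pi> ` I. (norm (\<Sum>X\<in>{X \<in> I. \<pi> X = a}. c X * \<psi> (mdot X T)))\<^sup>2) \<le>
    p * (real CARD('f ^ 'm ^ 'n) * (\<Sum>X\<in>I. (norm (c X))\<^sup>2))"
proof -
  let ?N = "real CARD('f ^ 'm ^ 'n)"
  have "(\<Sum>T\<in>S. \<Sum>a\<in>\<pi> ` I. (norm (\<Sum>X\<in>{X \<in> I. \<pi> X = a}. c X * \<psi> (mdot X T)))\<^sup>2) =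
      (\<Sum>a\<in>\<pi> ` I. \<Sum>T\<in>S. (norm (\<Sum>X\<in>{X \<in> I. \<pi> X = a}. c X * \<psi> (mdot X T)))\<^sup>2)"
    by (rule sum.swap)
  also have "\<dots> \<le> (\<Sum>a\<in>\<pi> ` I. p * (?N * (\<Sum>X\<in>{X \<in> I. \<pi> X = a}. (norm (c X))\<^sup>2)))"
    using assms by (intro sum_mono) (simp only: plancherel)
  also have "\<dots> = p * (?N * (\<Sum>a\<in>\<pi> ` I. \<Sum>X\<in>{X \<in> I. \<pi> X = a}. (norm (c X))\<^sup>2))"
    by (simp only: sum_distrib_left)
  also have "(\<Sum>a\<in>\<pi> ` I. \<Sum>X\<in>{X \<in> I. \<pi> X = a}. (norm (c X))\<^sup>2) = (\<Sum>X\<in>I. (norm (c X))\<^sup>2)"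
    by (rule sum.image_gen[symmetric]) simp
  finally show ?thesis .
qed

text \<open>All rank-one \<open>X\<close> with a given kernel have the form
  \<open>outer u v0\<close> with one fixed \<open>v0\<close>, so the class sum is a function of
  \<open>T *v v0\<close>, on whose fibres the density is bounded. The next lemma is the transposed
  argument.\<close>

lemma sum_ker_classes_le:
  fixes S :: "('f ^ 'm::finite ^ 'n::finite) set"
  assumes "\<And>v b. v \<noteq> 0 \<Longrightarrow> real (card {T \<in> S. T *v v = b}) \<le> p * real (card {T. T *v v = b})"
  shows "(\<Sum>T\<in>S. \<Sum>a\<in>ker ` (rank_one :: ('f ^ 'm ^ 'n) set).
      (norm (\<Sum>X\<in>{X \<in> rank_one. ker X = a}. c X * \<psi> (mdot X T)))\<^sup>2) \<le>
    p * (real CARD('f ^ 'm ^ 'n) * (\<Sum>X\<in>rank_one. (norm (c X))\<^sup>2))"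
proof (rule sum_classes_le)
  fix a :: "('f ^ 'm) set"
  assume "a \<in> ker ` (rank_one :: ('f ^ 'm ^ 'n) set)"
  then obtain u0 :: "'f ^ 'n" and v0 where a: "a = {w. dot v0 w = 0}" "u0 \<noteq> 0" "v0 \<noteq> 0"
    by (auto simp: rank_one_def ker_outer)
  have mdot_eq: "mdot X T = mdot X T'"
    if X: "X \<in> rank_one" "ker X = a" and T: "T *v v0 = T' *v v0" for X T T' :: "'f ^ 'm ^ 'n"
  proof -
    obtain u v where uv: "X = outer u v" "u \<noteq> 0" using X(1) by (auto simp: rank_one_def)
    then have "{w. dot v0 w = 0} = {w. dot v w = 0}" using X(2) a(1) by (simp add: ker_outer)
    then obtain d where "v = d *s v0" using perp_eq_imp_parallel[OF a(3)] by blast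
    then have "X = outer (d *s u) v0" using uv by (simp add: outer_scale)
    then show ?thesis using T by (simp add: mdot_outer)
  qed
  show "(\<Sum>T\<in>S. (norm (\<Sum>X\<in>{X \<in> rank_one. ker X = a}. c X * \<psi> (mdot X T)))\<^sup>2) \<le>
      p * (\<Sum>T\<in>UNIV. (norm (\<Sum>X\<in>{X \<in> rank_one. ker X = a}. c X * \<psi> (mdot X T)))\<^sup>2)"
  proof (rule sum_le_by_fibers[where \<kappa> = "\<lambda>T. T *v v0"])
    fix T T' :: "'f ^ 'm ^ 'n"
    assume T: "T *v v0 = T' *v v0"
    have "(\<Sum>X\<in>{X \<in> rank_one. ker X = a}. c X * \<psi> (mdot X T)) =
        (\<Sum>X\<in>{X \<in> rank_one. ker X = a}. c X * \<psi> (mdot X T'))"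
      using mdot_eq[OF _ _ T] by (intro sum.cong refl) auto
    then show "(norm (\<Sum>X\<in>{X \<in> rank_one. ker X = a}. c X * \<psi> (mdot X T)))\<^sup>2 =
        (norm (\<Sum>X\<in>{X \<in> rank_one. ker X = a}. c X * \<psi> (mdot X T')))\<^sup>2"
      by simp
  qed (use assms a(3) in auto)
qed

lemma sum_left_ker_classes_le:
  fixes S :: "('f ^ 'm::finite ^ 'n::finite) set"
  assumes "\<And>u b. u \<noteq> 0 \<Longrightarrow> real (card {T \<in> S. u v* T = b}) \<le> p * real (card {T. u v* T = b})"
  shows "(\<Sum>T\<in>S. \<Sum>a\<in>left_ker ` (rank_one :: ('f ^ 'm ^ 'n) set).
      (norm (\<Sum>X\<in>{X \<in> rank_one. left_ker X = a}. c X * \<psi> (mdot X T)))\<^sup>2) \<le>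
    p * (real CARD('f ^ 'm ^ 'n) * (\<Sum>X\<in>rank_one. (norm (c X))\<^sup>2))"
proof (rule sum_classes_le)
  fix a :: "('f ^ 'n) set"
  assume "a \<in> left_ker ` (rank_one :: ('f ^ 'm ^ 'n) set)"
  then obtain u0 and v0 :: "'f ^ 'm" where a: "a = {w. dot u0 w = 0}" "v0 \<noteq> 0" "u0 \<noteq> 0"
    by (auto simp: rank_one_def left_ker_outer)
  have mdot_eq: "mdot X T = mdot X T'"
    if X: "X \<in> rank_one" "left_ker X = a" and T: "u0 v* T = u0 v* T'" for X T T' :: "'f ^ 'm ^ 'n"
  proof -
    obtain u v where uv: "X = outer u v" "v \<noteq> 0" using X(1) by (auto simp: rank_one_def)
    then have "{w. dot u0 w = 0} = {w. dot u w = 0}" using X(2) a(1) by (simp add: left_ker_outer)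
    then obtain d where "u = d *s u0" using perp_eq_imp_parallel[OF a(3)] by blast
    then have "X = outer u0 (d *s v)" using uv by (simp add: outer_scale)
    then show ?thesis using T by (simp add: mdot_outer')
  qed
  show "(\<Sum>T\<in>S. (norm (\<Sum>X\<in>{X \<in> rank_one. left_ker X = a}. c X * \<psi> (mdot X T)))\<^sup>2) \<le>
      p * (\<Sum>T\<in>UNIV. (norm (\<Sum>X\<in>{X \<in> rank_one. left_ker X = a}. c X * \<psi> (mdot X T)))\<^sup>2)"
  proof (rule sum_le_by_fibers[where \<kappa> = "\<lambda>T. u0 v* T"])
    fix T T' :: "'f ^ 'm ^ 'n"
    assume T: "u0 v* T = u0 v* T'"
    have "(\<Sum>X\<in>{X \<in> rank_one. left_ker X = a}. c X * \<psi> (mdot X T)) =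
        (\<Sum>X\<in>{X \<in> rank_one. left_ker X = a}. c X * \<psi> (mdot X T'))"
      using mdot_eq[OF _ _ T] by (intro sum.cong refl) auto
    then show "(norm (\<Sum>X\<in>{X \<in> rank_one. left_ker X = a}. c X * \<psi> (mdot X T)))\<^sup>2 =
        (norm (\<Sum>X\<in>{X \<in> rank_one. left_ker X = a}. c X * \<psi> (mdot X T')))\<^sup>2"
      by simp
  qed (use assms a(3) in auto)
qed

text \<open>Cauchy-Schwarz over the pairs. Extended to all pairs, the products of coefficients
  contribute the square of the coefficient energy. In the other factor each difference occurs at
  most q^4 times by \<open>card_transversal_le\<close>, and the square root turns this into
  q^2.\<close>

lemma sum_transversal_le:
  fixes S :: "('f ^ 'm::finite ^ 'n::finite) set"
  shows "norm (\<Sum>(X, X')\<in>transversal. c X * cnj (c X') * fourier S (X - X')) \<le>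
    (real CARD('f))\<^sup>2 * (\<Sum>X\<in>rank_one. (norm (c X))\<^sup>2) *
      sqrt (\<Sum>Y\<in>rank_gt_one. (norm (fourier S Y))\<^sup>2)"
proof -
  define E1 where "E1 = (\<Sum>X\<in>rank_one. (norm (c X :: complex))\<^sup>2)"
  define E2 where "E2 = (\<Sum>Y\<in>rank_gt_one. (norm (fourier S Y))\<^sup>2)"
  define a where "a x = norm (c (fst x)) * norm (c (snd x))" for x :: "('f ^ 'm ^ 'n) \<times> ('f ^ 'm ^ 'n)"
  define b where "b x = norm (fourier S (fst x - snd x))" for x
  have E: "0 \<le> E1" "0 \<le> E2" by (auto simp: E1_def E2_def sum_nonneg)
  have "(\<Sum>x\<in>transversal. (a x)\<^sup>2) \<le> (\<Sum>x\<in>rank_one \<times> rank_one. (a x)\<^sup>2)"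
    by (rule sum_mono2) (auto simp: transversal_def)
  also have "\<dots> = E1\<^sup>2"
    by (simp add: a_def E1_def power_mult_distrib power2_eq_square[of "sum _ _"] sum_product
        sum.cartesian_product split_def)
  finally have A: "(\<Sum>x\<in>transversal. (a x)\<^sup>2) \<le> E1\<^sup>2" .
  have img: "(\<lambda>x. fst x - snd x) ` transversal \<subseteq> (rank_gt_one :: ('f ^ 'm ^ 'n) set)"
    using transversal_rank_gt_one by auto
  have "(\<Sum>x\<in>transversal. (b x)\<^sup>2) =
      (\<Sum>Y\<in>rank_gt_one. \<Sum>x\<in>{x \<in> transversal. fst x - snd x = Y}. (b x)\<^sup>2)"
    by (rule sum.group[OF finite finite img, symmetric])
  also have "\<dots> = (\<Sum>Y\<in>rank_gt_one. \<Sum>x\<in>{x \<in> transversal. fst x - snd x = Y}. (norm (fourier S Y))\<^sup>2)"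
    by (intro sum.cong refl) (auto simp: b_def)
  also have "\<dots> = (\<Sum>Y\<in>rank_gt_one. real (card {x \<in> transversal. fst x - snd x = Y}) * (norm (fourier S Y))\<^sup>2)"
    by simp
  also have "\<dots> \<le> (\<Sum>Y\<in>rank_gt_one. real (CARD('f) ^ 4) * (norm (fourier S Y))\<^sup>2)"
    by (intro sum_mono mult_right_mono of_nat_mono card_transversal_le) auto
  also have "\<dots> = real CARD('f) ^ 4 * E2" by (simp add: E2_def sum_distrib_left)
  finally have B: "(\<Sum>x\<in>transversal. (b x)\<^sup>2) \<le> real CARD('f) ^ 4 * E2" .
  have "norm (\<Sum>(X, X')\<in>transversal. c X * cnj (c X') * fourier S (X - X')) \<le> (\<Sum>x\<in>transversal. a x * b x)"
    by (rule order_trans[OF norm_sum]) (simp add: a_def b_def split_def norm_mult)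
  also have "\<dots> \<le> sqrt ((\<Sum>x\<in>transversal. (a x)\<^sup>2) * (\<Sum>x\<in>transversal. (b x)\<^sup>2))"
    by (rule real_le_rsqrt[OF Cauchy_Schwarz_ineq_sum])
  also have "\<dots> \<le> sqrt (E1\<^sup>2 * (real CARD('f) ^ 4 * E2))"
    by (intro real_sqrt_le_mono mult_mono A B) (auto simp: sum_nonneg)
  also have "\<dots> = sqrt (((real CARD('f))\<^sup>2 * E1)\<^sup>2 * E2)"
    by (simp add: power_mult_distrib power_mult[symmetric] ac_simps)
  also have "\<dots> = (real CARD('f))\<^sup>2 * E1 * sqrt E2"
    using E by (simp add: real_sqrt_mult)
  finally show ?thesis unfolding E1_def E2_def .
qed

text \<open>
  The pairs of rank-one matrices sharing both kernels are counted twice, but their contribution is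
  a sum of squares and can be dropped.
\<close>

lemma rank_one_energy_le:
  fixes S :: "('f ^ 'm::finite ^ 'n::finite) set"
  assumes zin: "\<And>v b. v \<noteq> 0 \<Longrightarrow> real (card {T \<in> S. T *v v = b}) \<le> p * real (card {T. T *v v = b})"
    and zout: "\<And>u b. u \<noteq> 0 \<Longrightarrow> real (card {T \<in> S. u v* T = b}) \<le> \<xi> * real (card {T. u v* T = b})"
    and "0 \<le> p" "0 \<le> \<xi>"
  shows "(\<Sum>X\<in>rank_one. (norm (fourier S X))\<^sup>2) \<le> real (card S) *
    ((p + \<xi>) * real CARD('f ^ 'm ^ 'n) +
     (real CARD('f))\<^sup>2 * sqrt (\<Sum>X\<in>rank_gt_one. (norm (fourier S X))\<^sup>2))"
proof -
  define N where "N = real CARD('f ^ 'm ^ 'n)"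
  define c where "c X = cnj (fourier S X)" for X
  define E1 where "E1 = (\<Sum>X\<in>rank_one. (norm (fourier S X))\<^sup>2)"
  define E2 where "E2 = (\<Sum>X\<in>rank_gt_one. (norm (fourier S X))\<^sup>2)"
  define t where "t T X = c X * \<psi> (mdot X T)" for X T
  \<comment> \<open>\<open>N\<close> times the projection of the indicator of \<open>S\<close> to
    the rank-one characters; the conjugate in \<open>c\<close> is the one from Fourier
    inversion.\<close>
  define f1 where "f1 T = (\<Sum>X\<in>rank_one. t T X)" for T
  define \<tau> where "\<tau> x = c (fst x) * cnj (c (snd x)) * fourier S (fst x - snd x)" for x
  define A :: "(('f ^ 'm ^ 'n) \<times> ('f ^ 'm ^ 'n)) set"
    where "A = {(X, X') \<in> rank_one \<times> rank_one. ker X = ker X'}"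
  define B :: "(('f ^ 'm ^ 'n) \<times> ('f ^ 'm ^ 'n)) set"
    where "B = {(X, X') \<in> rank_one \<times> rank_one. left_ker X = left_ker X'}"
  have norm_c: "norm (c X) = norm (fourier S X)" for X by (simp add: c_def)
  \<comment> \<open>The same pair sum in two forms: Fourier coefficients of \<open>S\<close> at
    differences serve the transversal pairs, and a sum over the points of \<open>S\<close> serves
    the classes.\<close>
  have expand: "(\<Sum>x\<in>P. \<tau> x) = (\<Sum>T\<in>S. \<Sum>(X, X')\<in>P. t T X * cnj (t T X'))" for P
  proof -
    have "\<tau> x = (\<Sum>T\<in>S. t T (fst x) * cnj (t T (snd x)))" for x
      by (simp add: \<tau>_def t_def fourier_def sum_distrib_left mdot_diff_left diff ac_simps)
    then show ?thesis by (simp add: split_def sum.swap[of _ S P])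
  qed
  have class_sum: "(\<Sum>x\<in>{(X, X') \<in> rank_one \<times> rank_one. \<pi> X = \<pi> X'}. \<tau> x) =
      of_real (\<Sum>T\<in>S. \<Sum>a\<in>\<pi> ` rank_one. (norm (\<Sum>X\<in>{X \<in> rank_one. \<pi> X = a}. t T X))\<^sup>2)"
    for \<pi> :: "'f ^ 'm ^ 'n \<Rightarrow> 'c"
    unfolding expand by (simp only: sum_equivalent_pairs[OF finite] of_real_sum)
  have RA: "Re (sum \<tau> A) \<le> p * (N * E1)"
    unfolding A_def class_sum Re_complex_of_real t_def N_def E1_def norm_c[symmetric]
    by (rule sum_ker_classes_le[OF zin])
  have RB: "Re (sum \<tau> B) \<le> \<xi> * (N * E1)"
    unfolding B_def class_sum Re_complex_of_real t_def N_def E1_def norm_c[symmetric]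
    by (rule sum_left_ker_classes_le[OF zout])
  have RAB: "0 \<le> Re (sum \<tau> (A \<inter> B))"
  proof -
    have "A \<inter> B = {(X, X') \<in> rank_one \<times> rank_one. (ker X, left_ker X) = (ker X', left_ker X')}"
      unfolding A_def B_def by auto
    then show ?thesis
      using class_sum[of "\<lambda>X. (ker X, left_ker X)"] by (simp add: sum_nonneg)
  qed
  have RO: "Re (sum \<tau> transversal) \<le> (real CARD('f))\<^sup>2 * E1 * sqrt E2"
  proof -
    have "Re (sum \<tau> transversal) \<le> norm (sum \<tau> transversal)" by (rule complex_Re_le_cmod)
    also have "\<dots> \<le> (real CARD('f))\<^sup>2 * E1 * sqrt E2"
      using sum_transversal_le[of c S] unfolding \<tau>_def split_def E1_def E2_def norm_c .
    finally show ?thesis .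
  qed
  have "complex_of_real (\<Sum>T\<in>S. (norm (f1 T))\<^sup>2) = sum \<tau> (rank_one \<times> rank_one)"
    unfolding expand of_real_sum complex_norm_square f1_def cnj_sum sum_product
    by (simp add: sum.cartesian_product)
  also have "rank_one \<times> rank_one = (A \<union> B) \<union> transversal"
    unfolding A_def B_def transversal_def by auto
  also have "sum \<tau> \<dots> = sum \<tau> (A \<union> B) + sum \<tau> transversal"
    by (rule sum.union_disjoint) (auto simp: A_def B_def transversal_def)
  also have "sum \<tau> (A \<union> B) = sum \<tau> A + sum \<tau> B - sum \<tau> (A \<inter> B)"
    by (rule sum_Un) auto
  finally have "(\<Sum>T\<in>S. (norm (f1 T))\<^sup>2) =
      Re (sum \<tau> A) + Re (sum \<tau> B) - Re (sum \<tau> (A \<inter> B)) + Re (sum \<tau> transversal)"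
    by (metis Re_complex_of_real minus_complex.simps(1) plus_complex.simps(1))
  also have "\<dots> \<le> p * (N * E1) + \<xi> * (N * E1) + (real CARD('f))\<^sup>2 * E1 * sqrt E2"
    using RA RB RAB RO by linarith
  finally have moment: "(\<Sum>T\<in>S. (norm (f1 T))\<^sup>2) \<le> E1 * ((p + \<xi>) * N + (real CARD('f))\<^sup>2 * sqrt E2)"
    by (simp add: algebra_simps)
  \<comment> \<open>The energy is also the sum of \<open>f1\<close> over \<open>S\<close>.
    Cauchy-Schwarz over \<open>S\<close> bounds \<open>E1\<^sup>2\<close> by \<open>card S\<close>
    times the second moment, whose bound has a factor \<open>E1\<close> that cancels.\<close>
  have "complex_of_real E1 = (\<Sum>X\<in>rank_one. \<Sum>T\<in>S. t T X)"
    unfolding E1_def of_real_sum complex_norm_square t_def sum_distrib_left[symmetric] c_def fourier_def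
    by (simp add: mult.commute)
  also have "\<dots> = (\<Sum>T\<in>S. f1 T)" unfolding f1_def by (rule sum.swap)
  finally have "norm (complex_of_real E1) \<le> (\<Sum>T\<in>S. norm (f1 T) * 1)"
    using norm_sum[of f1 S] by simp
  moreover have "0 \<le> E1" by (simp add: E1_def sum_nonneg)
  ultimately have "E1\<^sup>2 \<le> (\<Sum>T\<in>S. norm (f1 T) * 1)\<^sup>2"
    by (intro power_mono) auto
  also have "\<dots> \<le> (\<Sum>T\<in>S. (norm (f1 T))\<^sup>2) * (\<Sum>T\<in>S. 1\<^sup>2)"
    by (rule Cauchy_Schwarz_ineq_sum)
  also have "\<dots> \<le> E1 * ((p + \<xi>) * N + (real CARD('f))\<^sup>2 * sqrt E2) * real (card S)"
    using mult_right_mono[OF moment, of "real (card S)"] by simp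
  finally have "E1 * E1 \<le> E1 * (real (card S) * ((p + \<xi>) * N + (real CARD('f))\<^sup>2 * sqrt E2))"
    by (simp add: power2_eq_square ac_simps)
  moreover have "0 \<le> real (card S) * ((p + \<xi>) * N + (real CARD('f))\<^sup>2 * sqrt E2)"
    using assms(3,4) by (simp add: N_def E2_def sum_nonneg)
  ultimately have "E1 \<le> real (card S) * ((p + \<xi>) * N + (real CARD('f))\<^sup>2 * sqrt E2)"
    using \<open>0 \<le> E1\<close> by (cases "E1 = 0") (auto simp: mult_le_cancel_left)
  then show ?thesis unfolding E1_def E2_def N_def .
qed

end

section \<open>Affine maps as matrices\<close>

definition homogenize :: "('f::field, 'n::finite, 'l::finite) affmap \<Rightarrow> 'f ^ 'l option ^ 'n" where
  "homogenize T = (\<chi> i j. case j of None \<Rightarrow> snd T $ i | Some k \<Rightarrow> fst T $ i $ k)"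

definition extend_vec :: "'f::field ^ 'l::finite \<Rightarrow> 'f \<Rightarrow> 'f ^ 'l option" where
  "extend_vec a t = (\<chi> j. case j of None \<Rightarrow> t | Some k \<Rightarrow> a $ k)"

lemma homogenize_nth [simp]:
  "homogenize T $ i $ None = snd T $ i" "homogenize T $ i $ Some k = fst T $ i $ k"
  by (simp_all add: homogenize_def)

lemma extend_vec_nth [simp]: "extend_vec a t $ None = t" "extend_vec a t $ Some k = a $ k"
  by (simp_all add: extend_vec_def)

lemma vec_option_eq_iff: "x = y \<longleftrightarrow> x $ None = y $ None \<and> (\<forall>k. x $ Some k = y $ Some k)"
  by (auto simp: vec_eq_iff) (metis option.exhaust)

lemma mat_option_eq_iff:
  "X = Y \<longleftrightarrow> (\<forall>i. X $ i $ None = Y $ i $ None) \<and> (\<forall>i k. X $ i $ Some k = Y $ i $ Some k)"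
  by (subst vec_eq_iff) (auto simp: vec_option_eq_iff)

lemma vec_eq_extend_vec: "v = extend_vec (\<chi> k. v $ Some k) (v $ None)"
  by (simp add: vec_option_eq_iff)

lemma bij_homogenize: "bij homogenize"
proof (rule bijI)
  show "inj (homogenize :: ('f::field, 'n::finite, 'l::finite) affmap \<Rightarrow> _)"
    unfolding inj_def mat_option_eq_iff by (auto simp: prod_eq_iff vec_eq_iff)
  show "surj (homogenize :: ('f::field, 'n::finite, 'l::finite) affmap \<Rightarrow> _)"
  proof (rule surjI)
    fix X :: "'f ^ 'l option ^ 'n"
    show "homogenize (\<chi> i k. X $ i $ Some k, \<chi> i. X $ i $ None) = X"
      by (simp add: mat_option_eq_iff)
  qed
qed

lemma inj_homogenize: "inj homogenize"
  using bij_homogenize by (rule bij_is_inj)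

lemma sum_UNIV_option: "sum f (UNIV :: 'l::finite option set) = f None + (\<Sum>k\<in>UNIV. f (Some k))"
  by (simp add: UNIV_option_conv sum.reindex)

lemma homogenize_mult_extend_vec: "homogenize T *v extend_vec a t = fst T *v a + t *s snd T"
  by (simp add: vec_eq_iff matrix_vector_mult_def sum_UNIV_option algebra_simps)

lemma mult_homogenize:
  "u v* homogenize T = extend_vec (u v* fst T) (\<Sum>i\<in>UNIV. u $ i * snd T $ i)"
  by (simp add: vec_option_eq_iff vector_matrix_mult_def mult.commute)

section \<open>Adjacency as a rank-one difference of matrices\<close>

lemma dim_hyperplane_complement:
  fixes W :: "('f::field ^ 'l::finite) set"
  assumes "vec.subspace W" "z \<notin> W"
  shows "vec.dim W = CARD('l) - 1 \<longleftrightarrow> (\<forall>y. \<exists>k. y - k *s z \<in> W)"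
proof -
  have span: "vec.span W = W" using assms(1) by (simp add: vec.span_eq_iff)
  have "vec.dim (insert z W) = vec.dim W + 1"
    using assms(2) by (simp add: vec.dim_insert span)
  \<comment> \<open>The subtraction is in the natural numbers; it can be undone because
    \<open>CARD('l)\<close> is positive.\<close>
  then have "vec.dim W = CARD('l) - 1 \<longleftrightarrow> vec.dim (insert z W) = CARD('l)"
    by (metis One_nat_def Suc_eq_plus1 Suc_pred diff_Suc_1 zero_less_card_finite)
  also have "\<dots> \<longleftrightarrow> vec.span (insert z W) = UNIV"
    by (metis vec.dim_eq_full vec.dimension_def card_cart_basis)
  also have "\<dots> \<longleftrightarrow> (\<forall>y. \<exists>k. y - k *s z \<in> W)"
    by (auto simp: vec.span_breakdown_eq span set_eq_iff)
  finally show ?thesis .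
qed

text \<open>If only \<open>w $ None\<close> is nonzero, then \<open>outer u w\<close> with
  \<open>u \<noteq> 0\<close> changes an affine map by a nonzero translation. The two maps then
  agree nowhere, so such directions are not edges.\<close>

definition nonvertical :: "('f::field ^ 'l::finite option) set" where
  "nonvertical = {w. \<exists>k. w $ Some k \<noteq> 0}"

definition edge_directions :: "('f::field ^ 'l::finite option ^ 'n::finite) set" where
  "edge_directions = {outer u w | u w. u \<noteq> 0 \<and> w \<in> nonvertical}"

lemma homogenize_diff_eq_outer_iff:
  "homogenize T2 - homogenize T1 = outer u (extend_vec k t) \<longleftrightarrow>
    fst T2 - fst T1 = outer u k \<and> snd T2 - snd T1 = t *s u"
  unfolding mat_option_eq_iff by (auto simp: vec_eq_iff mult.commute)

text \<open>The linear part of a difference of neighbours kills a hyperplane, hence is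
  \<open>outer u k\<close>, and agreement at a point \<open>x\<close> forces the translation part to
  be \<open>(- dot k x) *s u\<close>. Conversely, the affine map of
  \<open>outer u (extend_vec k t)\<close> vanishes where \<open>dot k y + t = 0\<close>, an affine
  hyperplane since \<open>k \<noteq> 0\<close>.\<close>

lemma affbilin_adj_iff:
  fixes T1 T2 :: "('f::field, 'n::finite, 'l::finite) affmap"
  shows "affbilin_adj T1 T2 \<longleftrightarrow> homogenize T2 - homogenize T1 \<in> edge_directions"
proof
  assume adj: "affbilin_adj T1 T2"
  then obtain x :: "'f ^ 'l" and W where W: "vec.subspace W" "vec.dim W = CARD('l) - 1"
    and agree: "\<And>w. w \<in> W \<Longrightarrow> aff_apply T1 (x + w) = aff_apply T2 (x + w)" and ne: "T1 \<noteq> T2"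
    unfolding affbilin_adj_def affine_subspace_dim_def by auto
  define M where "M = fst T2 - fst T1"
  define c where "c = snd T2 - snd T1"
  have app: "M *v (x + w) + c = 0" if "w \<in> W" for w
    using agree[OF that] unfolding aff_apply_def M_def c_def
    by (simp add: matrix_vector_mult_diff_rdistrib algebra_simps)
  have c: "c = - (M *v x)"
    using app[of 0] vec.subspace_0[OF W(1)] by (simp add: eq_neg_iff_add_eq_0 add.commute)
  have MW: "M *v w = 0" if "w \<in> W" for w
    using app[OF that] c by (simp add: matrix_vector_right_distrib)
  have "W \<noteq> UNIV"
  proof
    assume "W = UNIV"
    then have "CARD('l) = CARD('l) - 1" using W(2) by (simp add: card_cart_basis)
    then show False by (metis diff_less less_irrefl less_one zero_less_card_finite)
  qed
  then obtain z where z: "z \<notin> W" by blast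
  have "\<forall>y. \<exists>k. y - k *s z \<in> W" using dim_hyperplane_complement[OF W(1) z] W(2) by blast
  \<comment> \<open>\<open>\<kappa> y\<close> is the coordinate of \<open>y\<close> along
    \<open>z\<close> modulo \<open>W\<close>. Since \<open>M\<close> kills \<open>W\<close>, every
    column of \<open>M\<close> is a multiple of \<open>M *v z\<close>.\<close>
  then obtain \<kappa> where \<kappa>: "\<And>y. y - \<kappa> y *s z \<in> W" by metis
  define u where "u = M *v z"
  define k where "k = (\<chi> j. \<kappa> (axis j 1))"
  have "M *v y = \<kappa> y *s u" for y
    using MW[OF \<kappa>[of y]] by (simp add: u_def matrix_vector_mult_diff_distrib vector_scalar_commute)
  then have cols: "M *v axis j 1 = k $ j *s u" for j by (simp add: k_def)
  have "M $ i $ j = u $ i * k $ j" for i j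
  proof -
    have "M $ i $ j = (M *v axis j 1) $ i"
      using dot_axis[of "M $ i" j 1] by (simp add: matrix_vector_mult_def dot_def)
    then show ?thesis using cols[of j] by (simp add: mult.commute)
  qed
  then have M: "M = outer u k" unfolding vec_eq_iff outer_nth by blast
  have "M \<noteq> 0"
  proof
    assume "M = 0"
    then have "c = 0" using c by simp
    then show False using ne \<open>M = 0\<close> unfolding M_def c_def by (auto simp: prod_eq_iff)
  qed
  then have uk: "u \<noteq> 0" "k \<noteq> 0" using M by auto
  have "c = (- dot k x) *s u" using c unfolding M outer_mult_vec by (simp add: vec_eq_iff)
  then have "homogenize T2 - homogenize T1 = outer u (extend_vec k (- dot k x))"
    using M unfolding homogenize_diff_eq_outer_iff M_def c_def by blast
  moreover have "extend_vec k (- dot k x) \<in> nonvertical"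
    using uk(2) unfolding nonvertical_def by (auto simp: vec_eq_iff)
  ultimately show "homogenize T2 - homogenize T1 \<in> edge_directions"
    using uk(1) unfolding edge_directions_def by blast
next
  assume "homogenize T2 - homogenize T1 \<in> edge_directions"
  then obtain u w where uw: "homogenize T2 - homogenize T1 = outer u w" "u \<noteq> 0" "w \<in> nonvertical"
    unfolding edge_directions_def by blast
  define k where "k = (\<chi> j. w $ Some j)"
  define t where "t = w $ None"
  have w: "w = extend_vec k t" unfolding k_def t_def by (rule vec_eq_extend_vec)
  obtain j where j: "k $ j \<noteq> 0" using uw(3) unfolding nonvertical_def k_def by auto
  \<comment> \<open>A base point of the hyperplane \<open>dot k x + t = 0\<close>, supported at a
    coordinate where \<open>k\<close> is nonzero.\<close>
  define x where "x = axis j (- t / k $ j)"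
  define z where "z = axis j (1 :: 'f)"
  define W where "W = {y. dot k y = 0}"
  have W: "vec.subspace W"
    unfolding vec.subspace_def W_def by (auto simp: dot_add_right dot_scale_right)
  have "z \<notin> W" using j by (simp add: W_def z_def dot_axis)
  moreover have "y - (dot k y / k $ j) *s z \<in> W" for y
    using j by (simp add: W_def z_def dot_diff_right dot_scale_right dot_axis)
  ultimately have dim: "vec.dim W = CARD('l) - 1"
    using dim_hyperplane_complement[OF W] by blast
  have "aff_apply T1 (x + y) = aff_apply T2 (x + y)" if "y \<in> W" for y
  proof -
    have d: "dot k (x + y) + t = 0" using that j by (simp add: W_def x_def dot_add_right dot_axis)
    have M: "fst T2 - fst T1 = outer u k" and c: "snd T2 - snd T1 = t *s u"
      using uw(1) unfolding w homogenize_diff_eq_outer_iff by auto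
    have "aff_apply T2 (x + y) - aff_apply T1 (x + y) =
        (fst T2 - fst T1) *v (x + y) + (snd T2 - snd T1)"
      unfolding aff_apply_def by (simp add: matrix_vector_mult_diff_rdistrib)
    also have "\<dots> = (dot k (x + y) + t) *s u"
      unfolding M c outer_mult_vec by (simp add: vec_eq_iff algebra_simps)
    also have "\<dots> = 0" using d by simp
    finally show ?thesis by simp
  qed
  moreover have "T1 \<noteq> T2"
  proof
    assume "T1 = T2"
    then have "outer u w = 0" using uw(1) by simp
    moreover have "w \<noteq> 0" using uw(3) unfolding nonvertical_def by auto
    ultimately show False using uw(2) by simp
  qed
  ultimately show "affbilin_adj T1 T2"
    unfolding affbilin_adj_def affine_subspace_dim_def using W dim
    by (intro conjI exI[of _ "(\<lambda>y. x + y) ` W"]) auto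
qed

lemma zero_notin_nonvertical: "0 \<notin> nonvertical"
  by (simp add: nonvertical_def)

lemma scale_nonvertical: "c \<noteq> 0 \<Longrightarrow> w \<in> nonvertical \<Longrightarrow> c *s w \<in> nonvertical"
  by (simp add: nonvertical_def)

lemma nonvertical_nonempty: "nonvertical \<noteq> {}"
proof -
  have "1 \<in> nonvertical" by (simp add: nonvertical_def)
  then show ?thesis by blast
qed

lemma card_nonvertical:
  "card (nonvertical :: ('f::{field,finite} ^ 'l::finite option) set) + CARD('f) = CARD('f ^ 'l option)"
proof -
  have "- nonvertical = extend_vec (0 :: 'f ^ 'l) ` UNIV"
  proof (intro equalityI subsetI)
    fix w :: "'f ^ 'l option"
    assume "w \<in> - nonvertical"
    then have "w = extend_vec 0 (w $ None)" by (simp add: nonvertical_def vec_option_eq_iff)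
    then show "w \<in> extend_vec 0 ` UNIV" by blast
  qed (auto simp: nonvertical_def)
  moreover have "inj (extend_vec (0 :: 'f ^ 'l))"
    by (auto simp: inj_def vec_option_eq_iff)
  ultimately have "card (- nonvertical :: ('f ^ 'l option) set) = CARD('f)"
    by (simp add: card_image)
  moreover have "card (nonvertical :: ('f ^ 'l option) set) + card (- nonvertical :: ('f ^ 'l option) set) =
      CARD('f ^ 'l option)"
    by (subst card_Un_disjoint[symmetric]) (auto simp: Compl_partition)
  ultimately show ?thesis by linarith
qed

text \<open>Recording an edge by its direction and starting matrix makes the number of edges leaving
  vertices of \<open>S\<close> a product, and the edges inside \<open>S\<close> become the
  correlations used in \<open>rank_gt_one_energy_le\<close>. Nonemptiness of \<open>S\<close> keeps
  the quotient in \<open>edge_expansion\<close> from being 0 / 0.\<close>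

lemma edge_expansion_counts:
  fixes S :: "('f::{field,finite}, 'n::finite, 'l::finite) affmap set"
  assumes "S \<noteq> {}"
    and exp: "1 - edge_expansion affbilin_adj S \<ge> 1 / real CARD('f)"
  shows "real (card (homogenize ` S)) * real (card (edge_directions :: ('f ^ 'l option ^ 'n) set)) \<le>
    real CARD('f) *
      (\<Sum>D\<in>edge_directions. real (card {T \<in> homogenize ` S. T + D \<in> homogenize ` S}))"
proof -
  let ?h = "homogenize :: ('f, 'n, 'l) affmap \<Rightarrow> _"
  let ?G = "edge_directions :: ('f ^ 'l option ^ 'n) set"
  let ?all = "{(T, T'). T \<in> S \<and> affbilin_adj T T'}"
  let ?in = "{(T, T'). T \<in> S \<and> affbilin_adj T T' \<and> T' \<in> S}"
  let ?out = "{(T, T'). T \<in> S \<and> affbilin_adj T T' \<and> T' \<notin> S}"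
  let ?g = "\<lambda>(T, T'). (?h T' - ?h T, ?h T)"
  have inj: "inj_on ?g A" for A
    using inj_homogenize by (auto simp: inj_on_def)
  have onto: "\<exists>T'. ?h T' = X" for X using bij_homogenize by (metis bij_pointE)
  have "?g ` ?all = ?G \<times> ?h ` S"
  proof (intro equalityI subsetI)
    fix x assume "x \<in> ?G \<times> ?h ` S"
    then obtain D T where x: "x = (D, ?h T)" "D \<in> ?G" "T \<in> S" by auto
    obtain T' where T': "?h T' = ?h T + D" using onto by blast
    then have "x = ?g (T, T')" "(T, T') \<in> ?all" using x by (auto simp: affbilin_adj_iff)
    then show "x \<in> ?g ` ?all" by blast
  qed (auto simp: affbilin_adj_iff)
  then have all: "card ?all = card ?G * card (?h ` S)"
    using card_image[OF inj, of ?all] by (simp add: card_cartesian_product)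
  have "?g ` ?in = Sigma ?G (\<lambda>D. {T \<in> ?h ` S. T + D \<in> ?h ` S})"
  proof (intro equalityI subsetI)
    fix x assume "x \<in> Sigma ?G (\<lambda>D. {T \<in> ?h ` S. T + D \<in> ?h ` S})"
    then obtain D T T' where x: "x = (D, ?h T)" "D \<in> ?G" "T \<in> S" "T' \<in> S" "?h T + D = ?h T'" by auto
    then have "D = ?h T' - ?h T" by (metis add_diff_cancel_left')
    then have "x = ?g (T, T')" "(T, T') \<in> ?in" using x by (auto simp: affbilin_adj_iff)
    then show "x \<in> ?g ` ?in" by blast
  qed (auto simp: affbilin_adj_iff)
  then have inn: "card ?in = (\<Sum>D\<in>?G. card {T \<in> ?h ` S. T + D \<in> ?h ` S})"
    using card_image[OF inj, of ?in] by simp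
  have "?all = ?in \<union> ?out" "?in \<inter> ?out = {}" by auto
  then have split: "card ?all = card ?in + card ?out" by (metis (no_types, lifting) card_Un_disjoint finite)
  have "?G \<noteq> {}"
  proof -
    obtain w :: "'f ^ 'l option" where "w \<in> nonvertical" using nonvertical_nonempty by blast
    moreover have "(1 :: 'f ^ 'n) \<noteq> 0" by simp
    ultimately have "outer 1 w \<in> ?G" unfolding edge_directions_def by blast
    then show ?thesis by blast
  qed
  then have pos: "card ?all > 0" using assms(1) unfolding all by (simp add: card_gt_0_iff)
  have arith: "A \<le> q * I" if "1 - R / A \<ge> 1 / q" "A = I + R" "A > 0" "q > 0" for A I R q :: real
    using that by (simp add: field_simps)
  have "real (card ?all) \<le> real CARD('f) * real (card ?in)"
    by (rule arith[where R = "real (card ?out)"])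
      (use exp split pos in \<open>simp_all only: edge_expansion_def of_nat_add of_nat_0_less_iff
        zero_less_card_finite\<close>)
  then show ?thesis unfolding all inn by (simp add: mult.commute)
qed

lemma density_in_le_iff:
  fixes C :: "'v::finite set"
  assumes "C \<noteq> {}"
  shows "density_in C S \<le> p \<longleftrightarrow> real (card (C \<inter> S)) \<le> p * real (card C)"
  using assms by (simp add: density_in_def divide_le_eq card_gt_0_iff)

lemma card_homogenize_image:
  "card {X \<in> homogenize ` S. P X} = card ({T. P (homogenize T)} \<inter> S)"
  "card {X. P X} = card {T. P (homogenize T)}"
proof -
  have "{X \<in> homogenize ` S. P X} = homogenize ` ({T. P (homogenize T)} \<inter> S)" by auto
  then show "card {X \<in> homogenize ` S. P X} = card ({T. P (homogenize T)} \<inter> S)"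
    by (simp add: card_image[OF inj_on_subset[OF inj_homogenize subset_UNIV]])
  have "{X. P X} = homogenize ` {T. P (homogenize T)}"
    using surj_image_vimage_eq[OF bij_is_surj[OF bij_homogenize], of "{X. P X}"]
    by (simp add: vimage_def)
  then show "card {X. P X} = card {T. P (homogenize T)}"
    by (simp add: card_image[OF inj_on_subset[OF inj_homogenize subset_UNIV]])
qed

section \<open>Dense zoom-ins\<close>

lemma zoom_in_nonempty: "zoom_in a b \<noteq> {}"
proof -
  have "(0, b) \<in> zoom_in a b" by (simp add: zoom_in_def aff_apply_def)
  then show ?thesis by blast
qed

lemma pseudorandom_card_le:
  fixes S :: "'v::finite set"
  assumes "pseudorandom \<xi> \<C> S" "C \<in> \<C>"
  shows "real (card (C \<inter> S)) \<le> \<xi> * real (card C)"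
  using assms by (cases "C = {}") (auto simp: pseudorandom_def density_in_le_iff)

text \<open>The coordinate \<open>t = v $ None\<close> decides the type: for t = 0 the fibre is a
  linear zoom-in, otherwise division by \<open>t\<close> makes it an affine zoom-in at
  \<open>(1 / t) *s a\<close>. The sum \<open>p + \<xi>\<close> covers both, as the kernel classes
  need a single bound.\<close>

lemma homogenize_mult_vec_card_le:
  fixes S :: "('f::{field,finite}, 'n::finite, 'l::finite) affmap set"
  assumes zin: "\<And>a b. density_in (zoom_in a b) S \<le> p"
    and lin: "pseudorandom \<xi> {zoom_in_lin a b | a b. True} S"
    and "0 \<le> p" "0 \<le> \<xi>"
  shows "real (card {X \<in> homogenize ` S. X *v v = b}) \<le> (p + \<xi>) * real (card {X :: 'f ^ 'l option ^ 'n. X *v v = b})"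
proof -
  define a where "a = (\<chi> k. v $ Some k)"
  define t where "t = v $ None"
  have v: "v = extend_vec a t" unfolding a_def t_def by (rule vec_eq_extend_vec)
  let ?C = "{T. homogenize T *v v = b} :: ('f, 'n, 'l) affmap set"
  have "real (card (?C \<inter> S)) \<le> p * real (card ?C) \<or> real (card (?C \<inter> S)) \<le> \<xi> * real (card ?C)"
  proof (cases "t = 0")
    case True
    then have "?C = zoom_in_lin a b"
      by (auto simp: v homogenize_mult_extend_vec zoom_in_lin_def)
    then have "?C \<in> {zoom_in_lin a b | a b. True}" by blast
    then show ?thesis using pseudorandom_card_le[OF lin] by blast
  next
    case False
    have "fst T *v a + t *s snd T = b \<longleftrightarrow> fst T *v ((1 / t) *s a) + snd T = (1 / t) *s b"
      for T :: "('f, 'n, 'l) affmap"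
    proof -
      have "fst T *v ((1 / t) *s a) + snd T = (1 / t) *s (fst T *v a + t *s snd T)"
        using False by (simp add: vector_scalar_commute vec_eq_iff algebra_simps)
      moreover have "(1 / t) *s x = (1 / t) *s b \<longleftrightarrow> x = b" for x
        using False by (auto simp: vec_eq_iff)
      ultimately show ?thesis by simp
    qed
    then have "?C = zoom_in ((1 / t) *s a) ((1 / t) *s b)"
      by (simp add: v homogenize_mult_extend_vec zoom_in_def aff_apply_def)
    then show ?thesis using zin zoom_in_nonempty density_in_le_iff by metis
  qed
  moreover have "p * real (card ?C) \<le> (p + \<xi>) * real (card ?C)" "\<xi> * real (card ?C) \<le> (p + \<xi>) * real (card ?C)"
    using assms(3,4) by (auto intro: mult_right_mono)
  ultimately have "real (card (?C \<inter> S)) \<le> (p + \<xi>) * real (card ?C)" by linarith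
  then show ?thesis
    by (simp only: card_homogenize_image(1) card_homogenize_image(2)[of "\<lambda>X. X *v v = b"])
qed

text \<open>After homogenizing, the row vector \<open>u v* X\<close> records the linear and the
  translation condition at once, so the fibre is exactly a zoom-out.\<close>

lemma vec_mult_homogenize_card_le:
  fixes S :: "('f::{field,finite}, 'n::finite, 'l::finite) affmap set"
  assumes "pseudorandom \<xi> {zoom_out a b \<beta> | a b \<beta>. True} S"
  shows "real (card {X \<in> homogenize ` S. u v* X = b}) \<le> \<xi> * real (card {X :: 'f ^ 'l option ^ 'n. u v* X = b})"
proof -
  let ?C = "{T. u v* homogenize T = b} :: ('f, 'n, 'l) affmap set"
  have "?C = zoom_out u (\<chi> k. b $ Some k) (b $ None)"
    by (auto simp: mult_homogenize vec_option_eq_iff zoom_out_def vec_eq_iff[where 'b = 'l])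
  then have "?C \<in> {zoom_out a b \<beta> | a b \<beta>. True}" by blast
  then have "real (card (?C \<inter> S)) \<le> \<xi> * real (card ?C)" by (rule pseudorandom_card_le[OF assms])
  then show ?thesis
    by (simp only: card_homogenize_image(1) card_homogenize_image(2)[of "\<lambda>X. u v* X = b"])
qed

text \<open>With \<open>p\<close> the largest affine zoom-in density, Parseval and the two energy
  bounds give 1 \<le> p + (q^3 + q + 3) \<xi>. Here 2 \<xi> pays for zoom-outs and linear zoom-ins,
  \<xi> for the trivial character, q \<xi> for the energy above rank one, and q^3 \<xi> for the
  transversal pairs.\<close>

lemma ex_dense_zoom_in:
  fixes S :: "('f::{field,finite}, 'n::finite, 'l::finite) affmap set"
  assumes "0 \<le> \<xi>" and "S \<noteq> {}" and dens: "density_in UNIV S \<le> \<xi>"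
    and zout: "pseudorandom \<xi> {zoom_out a b \<beta> | a b \<beta>. True} S"
    and zlin: "pseudorandom \<xi> {zoom_in_lin a b | a b. True} S"
    and exp: "1 - edge_expansion affbilin_adj S \<ge> 1 / real CARD('f)"
  shows "\<exists>a b. density_in (zoom_in a b) S \<ge> 1 - 3 * real CARD('f) ^ 3 * \<xi>"
proof -
  obtain \<psi> :: "'f \<Rightarrow> complex" where "additive_character \<psi>"
    using ex_additive_character unfolding additive_character_def by blast
  then interpret additive_character \<psi> .
  define S' :: "('f ^ 'l option ^ 'n) set" where "S' = homogenize ` S"
  define q where "q = real CARD('f)"
  define N where "N = real CARD('f ^ 'l option ^ 'n)"
  define s where "s = real (card S')"
  define E1 where "E1 = (\<Sum>X\<in>rank_one. (norm (fourier S' X))\<^sup>2)"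
  define E2 where "E2 = (\<Sum>X\<in>rank_gt_one. (norm (fourier S' X))\<^sup>2)"
  define d where "d x = density_in (zoom_in (fst x) (snd x)) S" for x
  have "Max (range d) \<in> range d" by (rule Max_in) auto
  then obtain x where x: "Max (range d) = d x" by (rule rangeE)
  define p where "p = d x"
  have p_max: "density_in (zoom_in a b) S \<le> p" for a b
  proof -
    have "d (a, b) \<le> Max (range d)" by (rule Max_ge) auto
    then show ?thesis by (simp only: x p_def) (simp add: d_def)
  qed
  have "0 \<le> p" by (simp add: p_def d_def density_in_def)
  have q: "q \<ge> 2" using card_mono[of UNIV "{0, 1 :: 'f}"] by (simp add: q_def)
  have card_S': "card S' = card S"
    unfolding S'_def by (rule card_image[OF inj_on_subset[OF inj_homogenize subset_UNIV]])
  have "s > 0" using assms(2) by (simp add: s_def card_S' card_gt_0_iff)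
  have "N > 0" by (simp add: N_def)
  have sN: "s \<le> \<xi> * N"
  proof -
    have "CARD(('f, 'n, 'l) affmap) = CARD('f ^ 'l option ^ 'n)"
      by (rule bij_betw_same_card[OF bij_homogenize])
    then show ?thesis using dens density_in_le_iff[of UNIV S \<xi>] by (simp add: s_def card_S' N_def)
  qed
  have E2: "E2 \<le> q * s\<^sup>2"
    unfolding E2_def q_def s_def
  proof (rule rank_gt_one_energy_le[where W = nonvertical])
    show "real (card S') * real (card {outer u w | u w. u \<noteq> (0 :: 'f ^ 'n) \<and> w \<in> (nonvertical :: ('f ^ 'l option) set)}) \<le>
        real CARD('f) * (\<Sum>D\<in>{outer u w | u w. u \<noteq> (0 :: 'f ^ 'n) \<and> w \<in> (nonvertical :: ('f ^ 'l option) set)}.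
          real (card {T \<in> S'. T + D \<in> S'}))"
      using edge_expansion_counts[OF assms(2) exp] unfolding S'_def edge_directions_def .
  qed (simp_all only: zero_notin_nonvertical scale_nonvertical card_nonvertical nonvertical_nonempty
      not_False_eq_True)
  have "E1 \<le> s * ((p + \<xi> + \<xi>) * N + q\<^sup>2 * sqrt E2)"
    unfolding E1_def E2_def s_def q_def N_def
    by (rule rank_one_energy_le)
      (use \<open>0 \<le> p\<close> assms(1) p_max homogenize_mult_vec_card_le[OF _ zlin]
        vec_mult_homogenize_card_le[OF zout] in \<open>auto simp: S'_def\<close>)
  moreover have "E1 = N * s - s\<^sup>2 - E2"
    using parseval[of S'] by (simp add: E1_def E2_def s_def N_def)
  ultimately have "N * s - s\<^sup>2 - q * s\<^sup>2 \<le> s * ((p + 2 * \<xi>) * N + q\<^sup>2 * sqrt E2)"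
    using E2 by (simp add: algebra_simps)
  also have "\<dots> \<le> s * ((p + 2 * \<xi>) * N + q\<^sup>2 * (q * s))"
  proof -
    \<comment> \<open>The square root of q is rounded up to q, which keeps the bound polynomial;
      with the q^2 from the transversal pairs this produces q^3.\<close>
    have "E2 \<le> (q * s)\<^sup>2"
      using E2 q by (simp add: power_mult_distrib power2_eq_square[of q] mult_right_mono order_trans[OF E2])
    then have "sqrt E2 \<le> q * s" using q \<open>s > 0\<close> by (intro real_le_lsqrt) auto
    then show ?thesis using \<open>s > 0\<close> by (intro mult_left_mono add_left_mono) auto
  qed
  finally have "s * (N - s - q * s) \<le> s * ((p + 2 * \<xi>) * N + q ^ 3 * s)"
    by (simp add: algebra_simps power2_eq_square power3_eq_cube)
  then have "N - s - q * s \<le> (p + 2 * \<xi>) * N + q ^ 3 * s"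
    using \<open>s > 0\<close> by (simp only: mult_le_cancel_left_pos)
  then have "N \<le> (p + 2 * \<xi>) * N + (q ^ 3 + q + 1) * s"
    by (simp add: algebra_simps)
  also have "\<dots> \<le> (p + 2 * \<xi>) * N + (q ^ 3 + q + 1) * (\<xi> * N)"
    using q sN by (intro add_left_mono mult_left_mono) auto
  finally have "1 * N \<le> (p + (q ^ 3 + q + 3) * \<xi>) * N"
    by (simp add: algebra_simps)
  then have "1 \<le> p + (q ^ 3 + q + 3) * \<xi>"
    using \<open>N > 0\<close> by (simp only: mult_le_cancel_right_pos)
  also have "\<dots> \<le> p + 3 * q ^ 3 * \<xi>"
  proof -
    have "q * 2\<^sup>2 \<le> q * q\<^sup>2" using q by (intro mult_left_mono power_mono) auto
    then have "4 * q \<le> q ^ 3" by (simp add: power2_eq_square power3_eq_cube)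
    then have "q ^ 3 + q + 3 \<le> 3 * q ^ 3" using q by linarith
    then show ?thesis using assms(1) by (intro add_left_mono mult_right_mono) auto
  qed
  finally have "p \<ge> 1 - 3 * q ^ 3 * \<xi>" by linarith
  then show ?thesis unfolding p_def d_def q_def by blast
qed

section \<open>Comparison with the stated error term\<close>

theorem theorem2p9:
  fixes S :: "('f::{field,finite}, 'n::finite, 'l::finite) affmap set"
    and \<xi> :: real
    and q :: nat
  assumes "q = CARD('f)"
    and "0 \<le> \<xi>" and "\<xi> \<le> 1"
    and "S \<noteq> {}"
    and "density_in UNIV S \<le> \<xi>"
    and "pseudorandom \<xi> {zoom_out a b \<beta> | a b \<beta>. True} S"
    and "pseudorandom \<xi> {zoom_out_lin a b | a b. True} S"
    and "pseudorandom \<xi> {zoom_in_lin a b | a b. True} S"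
    and "1 - edge_expansion affbilin_adj S \<ge> 1 / real q"
  shows "\<exists>a b. density_in (zoom_in a b) S \<ge>
           1 - 1 / (real q - 1)\<^sup>2
             - real q ^ 3 / (real q - 1) * (4 * real q powr (- real CARD('l)) + 867 * \<xi> powr (1 / 4))"
proof -
  define B where "B = real q ^ 3 / (real q - 1)"
  define x where "x = \<xi> powr (1 / 4)"
  have q: "real q \<ge> 2" using card_mono[of UNIV "{0, 1 :: 'f}"] assms(1) by simp
  have x: "0 \<le> x" "x ^ 4 = \<xi>"
    using assms(2) by (auto simp: x_def powr_realpow'[symmetric] powr_powr)
  have B: "B * (real q - 1) = real q ^ 3" using q by (simp add: B_def)
  have "B \<ge> real q"
  proof -
    have "real q * (real q - 1) \<le> real q * (real q * real q)"
      using q by (intro mult_left_mono) (auto intro: order_trans[of _ "1 * real q"] mult_right_mono)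
    then show ?thesis using q by (simp add: B_def pos_le_divide_eq power3_eq_cube)
  qed
  then have "B > 0" using q by linarith
  obtain a b where ab: "density_in (zoom_in a b) S \<ge> 1 - 3 * real q ^ 3 * \<xi>"
    using ex_dense_zoom_in[OF assms(2,4-6,8)] assms(1,9) by blast
  have "density_in (zoom_in a b) S \<ge> 1 - B * (867 * x)"
  \<comment> \<open>If the error term reaches 1, nonnegativity of a density suffices. Otherwise
    \<open>x\<close> is so small that the fourth power in \<open>x ^ 4 = \<xi>\<close> outweighs the
    coefficient q^3.\<close>
  proof (cases "B * (867 * x) \<ge> 1")
    case True
    moreover have "density_in (zoom_in a b) S \<ge> 0" by (simp add: density_in_def)
    ultimately show ?thesis by linarith
  next
    case False
    have "real q * x \<le> B * x" using \<open>B \<ge> real q\<close> x(1) by (rule mult_right_mono)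
    moreover have "0 \<le> B * x" using \<open>B > 0\<close> x(1) by simp
    ultimately have qx: "real q * x \<le> 1" using False by linarith
    moreover have "1 * x \<le> real q * x" using q x(1) by (intro mult_right_mono) auto
    ultimately have "x \<le> 1" by linarith
    then have "x\<^sup>2 \<le> 1" using x(1) by (simp add: power_le_one)
    \<comment> \<open>One factor \<open>x\<close> is kept for the target, while
      \<open>(real q - 1) * x\<close> and \<open>x\<^sup>2\<close> are each at most 1. Only the
      factor 3 then has to fit below 867.\<close>
    have "real q ^ 3 * \<xi> = B * x * ((real q - 1) * x) * x\<^sup>2"
      unfolding B[symmetric] x(2)[symmetric] by (simp add: power2_eq_square power4_eq_xxxx)
    also have "\<dots> \<le> B * x * 1 * 1"
      using \<open>0 \<le> B * x\<close> qx q x(1) \<open>x\<^sup>2 \<le> 1\<close>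
      by (intro mult_mono mult_left_mono) (auto simp: algebra_simps)
    finally have "3 * real q ^ 3 * \<xi> \<le> B * (867 * x)" using \<open>0 \<le> B * x\<close> by linarith
    then show ?thesis using ab by linarith
  qed
  moreover have "B * (867 * x) \<le> B * (4 * real q powr (- real CARD('l)) + 867 * x)"
    using \<open>B > 0\<close> by (intro mult_left_mono) auto
  moreover have "0 \<le> 1 / (real q - 1)\<^sup>2" by simp
  ultimately have "density_in (zoom_in a b) S \<ge> 1 - 1 / (real q - 1)\<^sup>2
      - B * (4 * real q powr (- real CARD('l)) + 867 * x)" by linarith
  then show ?thesis unfolding B_def x_def by blast
qed

end
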